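(* There is an absolute constant $C$ with the following property. Let $D$ be a natural number and suppose that $A, B \subseteq \mathbf{Z}^D$ are finite non-empty sets. Then there are $A' \subseteq A$ and $B' \subseteq B$ with $$|A'||B'| \geq e^{-C d_{\mathrm{ent}}(A,B)}|A||B|,$$ and such that $\dim_* (A') \leq C d_{\mathrm{ent}}(A,B)$ and $\dim_*(B') \leq C d_{\mathrm{ent}}(A, B)$.
   Context: Entropy. Let $G$ be an (additively written) abelian group. The Shannon entropy of a random variable $X$ taking values in a finite subset of $G$ is $\mathbf{H}(X) = \sum_x p_X(x)\log\frac{1}{p_X(x)}$, where $p_X(x)=\mathbf{P}(X=x)$, $\log$ is the natural logarithm, and terms with $p_X(x)=0$ are $0$. For two such random variables $X,Y$ the entropic Ruzsa distance is $$d_{\mathrm{ent}}(X,Y) = \mathbf{H}(X'-Y') - \tfrac12 \mathbf{H}(X') - \tfrac12\mathbf{H}(Y'),$$ where $X',Y'$ are independent copies of $X,Y$ respectively. For finite non-empty sets $A,B\subseteq G$, $d_{\mathrm{ent}}(A,B)$ means $d_{\mathrm{ent}}(U_A,U_B)$, where $U_A,U_B$ are uniform random variables on $A,B$. Here $G=\mathbf{Z}^D$. Skew-dimension. An affine coordinate space is a subset of $\mathbf{Z}^D$ (for some $D$) obtained by fixing the values of some possibly empty set of coordinates; for instance $\{(2,-1,x_3): x_3\in\mathbf{Z}\}\subseteq \mathbf{Z}^3$. If $A$ is a finite subset of some affine coordinate space $V$, its skew-dimension $\dim_*(A)$ is defined inductively: $\dim_*(A)=0$ if and only if $A$ is a singleton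 (or empty); and for $r\geq 1$, $\dim_*(A)\leq r$ if and only if there is a coordinate map $\pi\colon V\to\mathbf{Z}$ such that $\dim_*(\pi^{-1}(n)\cap A)\leq r-1$ for all $n\in\mathbf{Z}$ (with $\pi^{-1}(n)\cap A$ viewed as a subset of the affine coordinate space $\pi^{-1}(n)$). *)

theory Defs
  imports "HOL-Probability.Probability" "HOL-Library.Function_Algebras"
begin

definition shannon_entropy :: "'a pmf \<Rightarrow> real" where
  "shannon_entropy p = (\<Sum>x\<in>set_pmf p. pmf p x * ln (1 / pmf p x))"

(* Entropy and Ruzsa distance depend only on the laws of the random variables, so they are
   defined on laws; pair_pmf p q is the joint law of independent copies.  The sum above is
   meaningful for finitely supported p only. *)
definition ent_dist :: "'a::ab_group_add pmf \<Rightarrow> 'a pmf \<Rightarrow> real" where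
  "ent_dist p q =
     shannon_entropy (map_pmf (\<lambda>(x, y). x - y) (pair_pmf p q))
       - shannon_entropy p / 2 - shannon_entropy q / 2"

definition ent_dist_set :: "'a::ab_group_add set \<Rightarrow> 'a set \<Rightarrow> real" where
  "ent_dist_set A B = ent_dist (pmf_of_set A) (pmf_of_set B)"

(* Z^D as a subgroup of the group nat => int with pointwise operations: a type of dimension D
   would not allow a constant that is uniform in D. *)
definition int_vecs :: "nat \<Rightarrow> (nat \<Rightarrow> int) set" where
  "int_vecs D = {x. \<forall>i\<ge>D. x i = 0}"

(* "skew_dim_le r I A" says that the skew-dimension of A is at most r, where A lies in an affine
   coordinate space V whose free (i.e. not fixed) coordinates are those in I.  The fixed values
   play no role.  The coordinate maps on V are the x i with i in I, and the fibre over n has free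
   coordinates I - {i}.  The first disjunct of the successor case makes the predicate monotone
   in r also when no free coordinate is left: there A has at most one point, so that its
   dimension 0 is at most every r. *)
primrec skew_dim_le :: "nat \<Rightarrow> nat set \<Rightarrow> (nat \<Rightarrow> int) set \<Rightarrow> bool" where
  "skew_dim_le 0 I A \<longleftrightarrow> A = {} \<or> (\<exists>a. A = {a})"
| "skew_dim_le (Suc r) I A \<longleftrightarrow>
     skew_dim_le r I A \<or> (\<exists>i\<in>I. \<forall>n. skew_dim_le r (I - {i}) {x \<in> A. x i = n})"

definition skew_dim :: "nat set \<Rightarrow> (nat \<Rightarrow> int) set \<Rightarrow> nat" where
  "skew_dim I A = (LEAST r. skew_dim_le r I A)"

lemma skew_dim_le_mono: "skew_dim_le r I A \<Longrightarrow> r \<le> s \<Longrightarrow> skew_dim_le s I A"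
  by (induction s) (auto simp: le_Suc_eq)

lemma skew_dim_le_card:
  assumes "finite I" and "\<And>x y j. x \<in> A \<Longrightarrow> y \<in> A \<Longrightarrow> j \<notin> I \<Longrightarrow> x j = y j"
  shows "skew_dim_le (card I) I A"
  using assms
proof (induction "card I" arbitrary: I A)
  case 0
  have "x = y" if "x \<in> A" "y \<in> A" for x y
  proof
    fix j
    show "x j = y j"
      by (rule "0.prems"(2)) (use that 0 in simp_all)
  qed
  then have "A = {} \<or> (\<exists>a. A = {a})"
    by blast
  then show ?case
    unfolding 0(1)[symmetric] by simp
next
  case (Suc r)
  then obtain i where i: "i \<in> I" by fastforce
  have "skew_dim_le (card (I - {i})) (I - {i}) {x \<in> A. x i = n}" for n
  proof (rule Suc.hyps(1))
    show "r = card (I - {i})"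
      using Suc.hyps(2) Suc.prems(1) i by simp
    show "finite (I - {i})"
      using Suc.prems(1) by simp
    show "x j = y j" if "x \<in> {x \<in> A. x i = n}" "y \<in> {x \<in> A. x i = n}" "j \<notin> I - {i}" for x y j
      using that Suc.prems(2)[of x y j] by (cases "j = i") simp_all
  qed
  moreover have "card (I - {i}) = r"
    using Suc.hyps(2) Suc.prems(1) i by simp
  ultimately show ?case
    unfolding Suc.hyps(2)[symmetric] using i by auto
qed

lemma skew_dim_le_iff:
  assumes "A \<subseteq> int_vecs D"
  shows "skew_dim {..<D} A \<le> r \<longleftrightarrow> skew_dim_le r {..<D} A"
proof -
  have "skew_dim_le (card {..<D}) {..<D} A"
  proof (rule skew_dim_le_card)
    fix x y j
    assume "x \<in> A" "y \<in> A" "j \<notin> {..<D}"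
    then have "x \<in> int_vecs D" "y \<in> int_vecs D" "D \<le> j"
      using assms by auto
    then show "x j = y j"
      by (simp add: int_vecs_def)
  qed simp
  then have "skew_dim_le (skew_dim {..<D} A) {..<D} A"
    unfolding skew_dim_def by (rule LeastI)
  then show ?thesis
    unfolding skew_dim_def by (blast intro: skew_dim_le_mono Least_le)
qed

end

(* By subadditivity of conditional entropy, the entropic Ruzsa distance d of A and B is at least the
   distance of their projections to a coordinate plus the average distance of the fibres over that
   projection. For integer-valued variables the distance is either bounded below by an absolute
   constant c or comparable to the sum of the two entropies: if the distance is tiny, both laws are
   almost invariant under most differences of the other one, which in the integers forces each of
   them to have an atom of mass close to 1. Now induct on |A| |B|, splitting along a nonconstant
   coordinate. If the entropies of the projections are small compared to their distance, some single
   pair of fibres is large enough to replace (A, B). Otherwise the average distance of the fibres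
   drops by c, and A', B' are unions of the best subsets of all fibres; this costs one dimension. *)

theory Submission
  imports Defs
begin

section \<open>Entropy and conditioning\<close>

text \<open>The atoms alone do not give an inequality linear in the distance, and a linear one is
  needed: the entropies of the projections have to be paid for even when the distance is arbitrarily
  small. It comes from decoding. The entropy of X given X - Y is at most the mean code length of any
  explicit guess of X. For nearly deterministic X and Y a good guess costs little more than a
  multiple of the probability of missing an atom, which is itself small compared to the entropies.
  Gluing has its own obstacle: the induction yields subsets that depend on a pair of fibres, whereas
  a union needs one subset per fibre. A dimension budget common to all useful pairs makes it
  possible to take a largest admissible subset of each fibre. Pairs whose distance drops by less
  than c/2 are discarded, since together they account for at most c/2 of a mean drop of at least c.
  For the others, e^t \<ge> t replaces the exponential gain by one linear in the drop, which can be
  averaged.\<close>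

lemma sum_map_pmf:
  fixes g :: "'b \<Rightarrow> real"
  assumes "finite (set_pmf p)"
  shows "(\<Sum>z\<in>set_pmf (map_pmf f p). pmf (map_pmf f p) z * g z) = (\<Sum>w\<in>set_pmf p. pmf p w * g (f w))"
proof -
  have "measure_pmf.expectation (map_pmf f p) g = (\<Sum>z\<in>set_pmf (map_pmf f p). pmf (map_pmf f p) z * g z)"
    using assms by (subst integral_measure_pmf_real[of "set_pmf (map_pmf f p)"]) (auto simp: mult.commute)
  moreover have "measure_pmf.expectation p (\<lambda>w. g (f w)) = (\<Sum>w\<in>set_pmf p. pmf p w * g (f w))"
    using assms by (subst integral_measure_pmf_real[of "set_pmf p"]) (auto simp: mult.commute)
  ultimately show ?thesis by simp
qed

text \<open>Written as an expectation over the source, entropies of different images of one variable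
  become sums over the same set and can be compared term by term.\<close>

lemma shannon_entropy_map_pmf:
  assumes "finite (set_pmf p)"
  shows "shannon_entropy (map_pmf f p) = (\<Sum>w\<in>set_pmf p. pmf p w * ln (1 / pmf (map_pmf f p) (f w)))"
  unfolding shannon_entropy_def using assms by (rule sum_map_pmf)

lemma pmf_map_pos: "w \<in> set_pmf p \<Longrightarrow> 0 < pmf (map_pmf f p) (f w)"
  by (simp add: pmf_positive)

lemma pmf_map_eq_sum:
  assumes "finite T" "T \<subseteq> f -` {v}" "set_pmf p \<inter> f -` {v} \<subseteq> T"
  shows "pmf (map_pmf f p) v = sum (pmf p) T"
proof -
  have "pmf (map_pmf f p) v = measure_pmf.prob p (f -` {v} \<inter> set_pmf p)"
    by (simp add: pmf_map measure_Int_set_pmf)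
  also have "f -` {v} \<inter> set_pmf p = T \<inter> set_pmf p"
    using assms by auto
  finally show ?thesis
    using assms(1) by (simp add: measure_Int_set_pmf measure_measure_pmf_finite)
qed

lemma shannon_entropy_nonneg: "0 \<le> shannon_entropy p"
  unfolding shannon_entropy_def
  by (intro sum_nonneg mult_nonneg_nonneg) (auto simp: pmf_le_1 pmf_positive)

lemma shannon_entropy_map_inj:
  assumes "inj_on f (set_pmf p)"
  shows "shannon_entropy (map_pmf f p) = shannon_entropy p"
  unfolding shannon_entropy_def set_map_pmf
  by (subst sum.reindex[OF assms]) (simp add: pmf_map_inj[OF assms])

lemma sum_pmf_subset_le_1: "finite S \<Longrightarrow> (\<Sum>x\<in>S. pmf p x) \<le> 1"
  by (metis measure_measure_pmf_finite measure_pmf.prob_le_1)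

text \<open>Gibbs' inequality, from ln t \<le> t - 1 at each point. Neither function has to be
  normalised, so \<open>a\<close> may be a sub-probability on the support of
  \<open>p\<close>.\<close>

lemma sum_log_ratio_nonneg:
  fixes p a :: "'a \<Rightarrow> real"
  assumes "finite S" "\<And>x. x \<in> S \<Longrightarrow> 0 < p x" "\<And>x. x \<in> S \<Longrightarrow> 0 < a x" "sum a S \<le> sum p S"
  shows "0 \<le> (\<Sum>x\<in>S. p x * ln (p x / a x))"
proof -
  have "p x - a x \<le> p x * ln (p x / a x)" if "x \<in> S" for x
  proof -
    have "ln (a x / p x) \<le> a x / p x - 1"
      using assms(2,3)[OF that] by (intro ln_le_minus_one) simp
    then have "p x * ln (a x / p x) \<le> a x - p x"
      using assms(2)[OF that] by (simp add: field_simps)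
    then show ?thesis
      using assms(2,3)[OF that] by (simp add: ln_div algebra_simps)
  qed
  then have "(\<Sum>x\<in>S. p x - a x) \<le> (\<Sum>x\<in>S. p x * ln (p x / a x))"
    by (rule sum_mono)
  with assms(4) show ?thesis by (simp add: sum_subtractf)
qed

lemma shannon_entropy_pair_pmf:
  assumes "finite (set_pmf p)" "finite (set_pmf q)"
  shows "shannon_entropy (pair_pmf p q) = shannon_entropy p + shannon_entropy q"
proof -
  let ?P = "set_pmf p" and ?Q = "set_pmf q"
  have "shannon_entropy (pair_pmf p q)
      = (\<Sum>x\<in>?P. \<Sum>y\<in>?Q. pmf p x * ln (1 / pmf p x) * pmf q y + pmf p x * (pmf q y * ln (1 / pmf q y)))"
    unfolding shannon_entropy_def set_pair_pmf sum.cartesian_product'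
    by (intro sum.cong refl) (simp add: pmf_pair ln_div ln_mult pmf_positive algebra_simps)
  also have "\<dots> = shannon_entropy p * (\<Sum>y\<in>?Q. pmf q y) + (\<Sum>x\<in>?P. pmf p x) * shannon_entropy q"
    unfolding shannon_entropy_def sum_product sum.distrib by (simp add: mult.assoc)
  finally show ?thesis
    using assms by (simp add: sum_pmf_eq_1)
qed

text \<open>The gap is the mutual information of \<open>f\<close> and \<open>k\<close> given
  \<open>g\<close>. It is the relative entropy of the law \<open>t\<close> of the triple with
  respect to the law \<open>?A\<close> that has the same two pair marginals but makes
  \<open>f\<close> and \<open>k\<close> conditionally independent, so Gibbs' inequality
  applies.\<close>

lemma shannon_entropy_submodular:
  assumes fin: "finite (set_pmf p)"
  shows "shannon_entropy (map_pmf (\<lambda>w. (f w, g w, k w)) p) + shannon_entropy (map_pmf g p)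
    \<le> shannon_entropy (map_pmf (\<lambda>w. (f w, g w)) p) + shannon_entropy (map_pmf (\<lambda>w. (g w, k w)) p)"
proof -
  define t where "t = map_pmf (\<lambda>w. (f w, g w, k w)) p"
  have fint: "finite (set_pmf t)" using fin by (simp add: t_def)
  define u where "u = map_pmf (\<lambda>(a, b, c). (a, b)) t"
  define v where "v = map_pmf (\<lambda>(a, b, c). (b, c)) t"
  define s where "s = map_pmf (\<lambda>(a, b, c). b) t"
  have us: "map_pmf snd u = s" and vs: "map_pmf fst v = s"
    by (simp_all add: u_def v_def s_def pmf.map_comp o_def case_prod_unfold)
  have pos: "0 < pmf t (a, b, c)" "0 < pmf u (a, b)" "0 < pmf v (b, c)" "0 < pmf s b"
    if "(a, b, c) \<in> set_pmf t" for a b c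
    using that pmf_map_pos[of "(a, b, c)" t "\<lambda>(a, b, c). (a, b)"]
      pmf_map_pos[of "(a, b, c)" t "\<lambda>(a, b, c). (b, c)"] pmf_map_pos[of "(a, b, c)" t "\<lambda>(a, b, c). b"]
    by (auto simp: u_def v_def s_def pmf_positive)
  let ?A = "\<lambda>(a, b, c). pmf u (a, b) * pmf v (b, c) / pmf s b"
  have finu: "finite (set_pmf u)" and finv: "finite (set_pmf v)" and fins: "finite (set_pmf s)"
    using fint by (simp_all add: u_def v_def s_def)
  let ?F = "fst ` set_pmf u" and ?G = "set_pmf s" and ?K = "snd ` set_pmf v"
  have sub: "set_pmf t \<subseteq> ?F \<times> ?G \<times> ?K"
    unfolding u_def v_def s_def by force
  have fu: "(\<Sum>a\<in>?F. pmf u (a, b)) = pmf s b" for b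
  proof -
    have "pmf s b = (\<Sum>x\<in>?F \<times> {b}. pmf u x)"
      unfolding us[symmetric] by (rule pmf_map_eq_sum) (use finu in \<open>auto, force+\<close>)
    then show ?thesis by (simp add: sum.cartesian_product')
  qed
  have fv: "(\<Sum>c\<in>?K. pmf v (b, c)) = pmf s b" for b
  proof -
    have "pmf s b = (\<Sum>x\<in>{b} \<times> ?K. pmf v x)"
      unfolding vs[symmetric] by (rule pmf_map_eq_sum) (use finv in \<open>auto, force+\<close>)
    then show ?thesis by (simp add: sum.cartesian_product')
  qed
  \<comment> \<open>The support of \<open>t\<close> may be smaller than that of \<open>?A\<close>;
    on the enclosing box \<open>?A\<close> has total mass 1.\<close>
  have "sum ?A (set_pmf t) \<le> sum ?A (?F \<times> ?G \<times> ?K)"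
    by (rule sum_mono2) (use sub finu finv fins in auto)
  also have "\<dots> = (\<Sum>a\<in>?F. \<Sum>b\<in>?G. \<Sum>c\<in>?K. pmf u (a, b) * pmf v (b, c) / pmf s b)"
    by (simp add: sum.cartesian_product')
  also have "\<dots> = (\<Sum>a\<in>?F. \<Sum>b\<in>?G. pmf u (a, b))"
    by (simp add: sum_distrib_left[symmetric] sum_divide_distrib[symmetric] fv)
      (intro sum.cong refl, simp add: set_pmf_iff)
  also have "\<dots> = 1"
    by (subst sum.swap) (simp add: fu sum_pmf_eq_1 fins)
  finally have "sum ?A (set_pmf t) \<le> sum (pmf t) (set_pmf t)"
    by (simp add: sum_pmf_eq_1 fint)
  then have "0 \<le> (\<Sum>x\<in>set_pmf t. pmf t x * ln (pmf t x / ?A x))"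
    by (intro sum_log_ratio_nonneg fint) (auto simp: pos)
  also have "\<dots> = shannon_entropy u + shannon_entropy v - shannon_entropy t - shannon_entropy s"
  proof -
    have "pmf t x * ln (pmf t x / ?A x) = pmf t x * ln (1 / pmf u (case x of (a, b, c) \<Rightarrow> (a, b)))
       + pmf t x * ln (1 / pmf v (case x of (a, b, c) \<Rightarrow> (b, c)))
       - pmf t x * ln (1 / pmf t x) - pmf t x * ln (1 / pmf s (case x of (a, b, c) \<Rightarrow> b))"
      if "x \<in> set_pmf t" for x
    proof -
      obtain a b c where x: "x = (a, b, c)" by (cases x)
      show ?thesis using pos[of a b c] that
        by (simp add: x ln_div ln_mult algebra_simps)
    qed
    then have "(\<Sum>x\<in>set_pmf t. pmf t x * ln (pmf t x / ?A x)) = (\<Sum>x\<in>set_pmf t.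
         pmf t x * ln (1 / pmf u (case x of (a, b, c) \<Rightarrow> (a, b)))
       + pmf t x * ln (1 / pmf v (case x of (a, b, c) \<Rightarrow> (b, c)))
       - pmf t x * ln (1 / pmf t x) - pmf t x * ln (1 / pmf s (case x of (a, b, c) \<Rightarrow> b)))"
      by (rule sum.cong[OF refl])
    then show ?thesis
      using shannon_entropy_map_pmf[OF fint, of "\<lambda>(a, b, c). (a, b)", folded u_def]
        shannon_entropy_map_pmf[OF fint, of "\<lambda>(a, b, c). (b, c)", folded v_def]
        shannon_entropy_map_pmf[OF fint, of "\<lambda>(a, b, c). b", folded s_def]
      by (simp add: shannon_entropy_def[of t] sum.distrib sum_subtractf id_def)
  qed
  finally show ?thesis
    by (simp add: u_def v_def s_def t_def pmf.map_comp o_def)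
qed

text \<open>On the fibre over \<open>v\<close> the law of \<open>f\<close> is the joint law divided
  by the mass of the fibre. Both sides are thus the same sum over points \<open>w\<close>, regrouped
  by the value of \<open>g\<close>.\<close>

lemma shannon_entropy_chain:
  assumes fin: "finite (set_pmf p)"
  shows "shannon_entropy (map_pmf (\<lambda>w. (f w, g w)) p) = shannon_entropy (map_pmf g p)
    + (\<Sum>v\<in>set_pmf (map_pmf g p). pmf (map_pmf g p) v * shannon_entropy (map_pmf f (cond_pmf p (g -` {v}))))"
proof -
  let ?G = "map_pmf g p" and ?J = "map_pmf (\<lambda>w. (f w, g w)) p"
  let ?h = "\<lambda>w. pmf p w * (ln (1 / pmf ?J (f w, g w)) - ln (1 / pmf ?G (g w)))"
  have fibre: "pmf ?G v * shannon_entropy (map_pmf f (cond_pmf p (g -` {v})))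
      = sum ?h {w \<in> set_pmf p. g w = v}" if v: "v \<in> set_pmf ?G" for v
  proof -
    let ?c = "cond_pmf p (g -` {v})"
    have ne: "set_pmf p \<inter> g -` {v} \<noteq> {}" using v by auto
    have posv: "0 < pmf ?G v" using v by (simp add: pmf_positive)
    have pc: "pmf ?c w = pmf p w / pmf ?G v" if "g w = v" for w
      using that by (simp add: pmf_cond[OF ne] pmf_map)
    have set_c: "set_pmf ?c = {w \<in> set_pmf p. g w = v}"
      using ne by (auto simp: set_cond_pmf)
    have mc: "pmf (map_pmf f ?c) a = pmf ?J (a, v) / pmf ?G v" for a
    proof -
      let ?T = "{w \<in> set_pmf p. f w = a \<and> g w = v}"
      have "pmf (map_pmf f ?c) a = sum (pmf ?c) ?T"
        using fin by (intro pmf_map_eq_sum) (auto simp: set_c)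
      also have "\<dots> = sum (pmf p) ?T / pmf ?G v"
        by (simp add: sum_divide_distrib pc)
      also have "sum (pmf p) ?T = pmf ?J (a, v)"
        using fin by (intro pmf_map_eq_sum[symmetric]) auto
      finally show ?thesis .
    qed
    have "pmf ?G v * shannon_entropy (map_pmf f ?c)
        = (\<Sum>w\<in>{w \<in> set_pmf p. g w = v}. pmf ?G v * (pmf ?c w * ln (1 / pmf (map_pmf f ?c) (f w))))"
      using fin by (subst shannon_entropy_map_pmf) (simp_all add: set_c sum_distrib_left)
    also have "\<dots> = sum ?h {w \<in> set_pmf p. g w = v}"
    proof (rule sum.cong[OF refl])
      fix w assume w: "w \<in> {w \<in> set_pmf p. g w = v}"
      then have "0 < pmf ?J (f w, v)"
        using pmf_map_pos[of w p "\<lambda>w. (f w, g w)"] by auto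
      then show "pmf ?G v * (pmf ?c w * ln (1 / pmf (map_pmf f ?c) (f w))) = ?h w"
        using w posv by (simp add: pc mc ln_div)
    qed
    finally show ?thesis .
  qed
  have "sum ?h (set_pmf p) = (\<Sum>v\<in>set_pmf ?G. sum ?h {w \<in> set_pmf p. g w = v})"
    using sum.image_gen[OF fin, of ?h g] by simp
  also have "\<dots> = (\<Sum>v\<in>set_pmf ?G. pmf ?G v * shannon_entropy (map_pmf f (cond_pmf p (g -` {v}))))"
    by (rule sum.cong[OF refl]) (simp only: fibre)
  finally show ?thesis
    using fin by (simp add: shannon_entropy_map_pmf[OF fin] right_diff_distrib sum_subtractf)
qed

lemma cond_pair_pmf:
  assumes "set_pmf p \<inter> S \<noteq> {}" "set_pmf q \<inter> T \<noteq> {}"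
  shows "cond_pmf (pair_pmf p q) (S \<times> T) = pair_pmf (cond_pmf p S) (cond_pmf q T)"
proof -
  have ne: "set_pmf (pair_pmf p q) \<inter> (S \<times> T) \<noteq> {}"
    using assms by auto
  have "measure_pmf.prob (pair_pmf p q) (S \<times> T) = measure_pmf.prob p S * measure_pmf.prob q T"
  proof -
    have "measure_pmf.prob (pair_pmf p q) (S \<times> T)
        = measure_pmf.prob (pair_pmf p q) ((S \<inter> set_pmf p) \<times> (T \<inter> set_pmf q))"
      by (subst measure_Int_set_pmf[symmetric]) (simp add: Times_Int_Times)
    also have "\<dots> = measure_pmf.prob p (S \<inter> set_pmf p) * measure_pmf.prob q (T \<inter> set_pmf q)"
      by (rule measure_pmf_prob_product) auto
    finally show ?thesis by (simp add: measure_Int_set_pmf)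
  qed
  then show ?thesis
    by (intro pmf_eqI)
      (auto simp: pmf_cond[OF ne] pmf_cond[OF assms(1)] pmf_cond[OF assms(2)] pmf_pair split: if_splits)
qed

section \<open>Entropic Ruzsa distance and its behaviour under homomorphisms\<close>

definition pmf_diff :: "'a::ab_group_add pmf \<Rightarrow> 'a pmf \<Rightarrow> 'a pmf" where
  "pmf_diff p q = map_pmf (\<lambda>(x, y). x - y) (pair_pmf p q)"

lemma ent_dist_alt: "ent_dist p q = shannon_entropy (pmf_diff p q) - shannon_entropy p / 2 - shannon_entropy q / 2"
  by (simp add: ent_dist_def pmf_diff_def)

lemma ent_dist_commute: "ent_dist p q = ent_dist q p"
proof -
  have "pmf_diff q p = map_pmf uminus (pmf_diff p q)"
    unfolding pmf_diff_def by (subst pair_commute_pmf) (simp add: pmf.map_comp o_def case_prod_unfold)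
  then show ?thesis
    by (simp add: ent_dist_alt shannon_entropy_map_inj)
qed

text \<open>The defect is the conditional mutual information of the difference and the pair of
  projections, given the difference of the projections.\<close>
lemma ent_dist_fibring:
  fixes \<pi> :: "'a::ab_group_add \<Rightarrow> 'b::ab_group_add"
  assumes fin: "finite (set_pmf p)" "finite (set_pmf q)"
    and hom: "\<And>x y. \<pi> (x - y) = \<pi> x - \<pi> y"
  shows "ent_dist (map_pmf \<pi> p) (map_pmf \<pi> q)
      + (\<Sum>a\<in>set_pmf (map_pmf \<pi> p). \<Sum>b\<in>set_pmf (map_pmf \<pi> q).
          pmf (map_pmf \<pi> p) a * pmf (map_pmf \<pi> q) b
            * ent_dist (cond_pmf p (\<pi> -` {a})) (cond_pmf q (\<pi> -` {b})))
    \<le> ent_dist p q"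
proof -
  let ?w = "pair_pmf p q" and ?P = "map_pmf \<pi> p" and ?Q = "map_pmf \<pi> q"
  let ?c = "\<lambda>a. cond_pmf p (\<pi> -` {a})" and ?d = "\<lambda>b. cond_pmf q (\<pi> -` {b})"
  let ?Z = "\<lambda>(x, y). x - y" and ?V = "\<lambda>(x, y). (\<pi> x, \<pi> y)" and ?W = "\<lambda>(x, y). \<pi> x - \<pi> y"
  have finw: "finite (set_pmf ?w)" using fin by simp
  have V: "map_pmf ?V ?w = pair_pmf ?P ?Q" by (simp add: map_pair)
  have sub: "shannon_entropy (map_pmf (\<lambda>w. (?Z w, ?W w, ?V w)) ?w) + shannon_entropy (map_pmf ?W ?w)
    \<le> shannon_entropy (map_pmf (\<lambda>w. (?Z w, ?W w)) ?w) + shannon_entropy (map_pmf (\<lambda>w. (?W w, ?V w)) ?w)"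
    by (rule shannon_entropy_submodular[OF finw])
  have e1: "shannon_entropy (map_pmf (\<lambda>w. (?Z w, ?W w, ?V w)) ?w) = shannon_entropy (map_pmf (\<lambda>w. (?Z w, ?V w)) ?w)"
  proof -
    have "map_pmf (\<lambda>w. (?Z w, ?W w, ?V w)) ?w
       = map_pmf (\<lambda>(z, a, b). (z, a - b, a, b)) (map_pmf (\<lambda>w. (?Z w, ?V w)) ?w)"
      by (simp add: pmf.map_comp o_def case_prod_unfold)
    then show ?thesis by (simp add: shannon_entropy_map_inj inj_on_def split: prod.splits)
  qed
  have e2: "shannon_entropy (map_pmf (\<lambda>w. (?Z w, ?W w)) ?w) = shannon_entropy (pmf_diff p q)"
  proof -
    have "map_pmf (\<lambda>w. (?Z w, ?W w)) ?w = map_pmf (\<lambda>z. (z, \<pi> z)) (pmf_diff p q)"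
      by (simp add: pmf_diff_def pmf.map_comp o_def case_prod_unfold hom)
    then show ?thesis by (simp add: shannon_entropy_map_inj inj_on_def)
  qed
  have e3: "shannon_entropy (map_pmf (\<lambda>w. (?W w, ?V w)) ?w) = shannon_entropy (pair_pmf ?P ?Q)"
  proof -
    have "map_pmf (\<lambda>w. (?W w, ?V w)) ?w = map_pmf (\<lambda>(a, b). (a - b, a, b)) (map_pmf ?V ?w)"
      by (simp add: pmf.map_comp o_def case_prod_unfold)
    then show ?thesis unfolding V by (simp add: shannon_entropy_map_inj inj_on_def split: prod.splits)
  qed
  have e4: "map_pmf ?W ?w = pmf_diff ?P ?Q"
    unfolding pmf_diff_def V[symmetric] by (simp add: pmf.map_comp o_def case_prod_unfold)
  have cond: "map_pmf ?Z (cond_pmf ?w (?V -` {(a, b)})) = pmf_diff (?c a) (?d b)"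
    if "a \<in> set_pmf ?P" "b \<in> set_pmf ?Q" for a b
  proof -
    have "?V -` {(a, b)} = \<pi> -` {a} \<times> \<pi> -` {b}" by auto
    moreover have "set_pmf p \<inter> \<pi> -` {a} \<noteq> {}" "set_pmf q \<inter> \<pi> -` {b} \<noteq> {}" using that by auto
    ultimately show ?thesis by (simp add: cond_pair_pmf pmf_diff_def)
  qed
  have chainZ: "shannon_entropy (map_pmf (\<lambda>w. (?Z w, ?V w)) ?w) = shannon_entropy (pair_pmf ?P ?Q)
     + (\<Sum>a\<in>set_pmf ?P. \<Sum>b\<in>set_pmf ?Q. pmf ?P a * pmf ?Q b * shannon_entropy (pmf_diff (?c a) (?d b)))"
    unfolding shannon_entropy_chain[OF finw] V set_pair_pmf sum.cartesian_product'
    by (intro arg_cong2[where f = "(+)"] refl sum.cong) (simp only: cond pmf_pair)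
  have chain: "shannon_entropy r = shannon_entropy (map_pmf \<pi> r)
     + (\<Sum>a\<in>set_pmf (map_pmf \<pi> r). pmf (map_pmf \<pi> r) a * shannon_entropy (cond_pmf r (\<pi> -` {a})))"
    if "finite (set_pmf r)" for r
    using shannon_entropy_chain[OF that, of "\<lambda>x. x" \<pi>]
    by (simp add: shannon_entropy_map_inj inj_on_def)
  have sP: "(\<Sum>a\<in>set_pmf ?P. pmf ?P a) = 1" and sQ: "(\<Sum>b\<in>set_pmf ?Q. pmf ?Q b) = 1"
    by (intro sum_pmf_eq_1; use fin in simp)+
  \<comment> \<open>\<open>DP\<close> and \<open>DQ\<close> are the entropies of the two variables
    conditioned on their projections; the chain rule subtracts them off the entropies of
    \<open>p\<close> and \<open>q\<close>.\<close>
  define DP where "DP = (\<Sum>a\<in>set_pmf ?P. pmf ?P a * shannon_entropy (?c a))"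
  define DQ where "DQ = (\<Sum>b\<in>set_pmf ?Q. pmf ?Q b * shannon_entropy (?d b))"
  have s1: "(\<Sum>a\<in>set_pmf ?P. \<Sum>b\<in>set_pmf ?Q. pmf ?P a * pmf ?Q b * shannon_entropy (?c a)) = DP"
  proof -
    have "(\<Sum>a\<in>set_pmf ?P. \<Sum>b\<in>set_pmf ?Q. pmf ?P a * pmf ?Q b * shannon_entropy (?c a)) = DP * (\<Sum>b\<in>set_pmf ?Q. pmf ?Q b)"
      unfolding DP_def sum_product by (simp add: mult_ac)
    then show ?thesis unfolding sQ by simp
  qed
  have s2: "(\<Sum>a\<in>set_pmf ?P. \<Sum>b\<in>set_pmf ?Q. pmf ?P a * pmf ?Q b * shannon_entropy (?d b)) = DQ"
  proof -
    have "(\<Sum>a\<in>set_pmf ?P. \<Sum>b\<in>set_pmf ?Q. pmf ?P a * pmf ?Q b * shannon_entropy (?d b)) = (\<Sum>a\<in>set_pmf ?P. pmf ?P a) * DQ"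
      unfolding DQ_def sum_product by (simp add: mult_ac)
    then show ?thesis unfolding sP by simp
  qed
  have "(\<Sum>a\<in>set_pmf ?P. \<Sum>b\<in>set_pmf ?Q. pmf ?P a * pmf ?Q b * ent_dist (?c a) (?d b))
     = (\<Sum>a\<in>set_pmf ?P. \<Sum>b\<in>set_pmf ?Q. pmf ?P a * pmf ?Q b * shannon_entropy (pmf_diff (?c a) (?d b)))
       - DP / 2 - DQ / 2"
    unfolding s1[symmetric] s2[symmetric] ent_dist_alt
    by (simp only: right_diff_distrib sum_subtractf times_divide_eq_right sum_divide_distrib)
  then show ?thesis
    using sub[unfolded e4] e1 e2 e3 chainZ chain[OF fin(1), folded DP_def] chain[OF fin(2), folded DQ_def]
    unfolding ent_dist_alt by linarith
qed

section \<open>Total variation and translates\<close>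

text \<open>No absolute value is needed, because complementary events have opposite differences.
  With a supremum over all events, contraction under maps is immediate.\<close>

definition tv_dist :: "'a pmf \<Rightarrow> 'a pmf \<Rightarrow> real" where
  "tv_dist p q = (SUP S. measure_pmf.prob p S - measure_pmf.prob q S)"

lemma prob_diff_le_tv_dist: "measure_pmf.prob p S - measure_pmf.prob q S \<le> tv_dist p q"
  unfolding tv_dist_def
proof (rule cSUP_upper)
  show "bdd_above (range (\<lambda>S. measure_pmf.prob p S - measure_pmf.prob q S))"
    by (rule bdd_aboveI[of _ 1])
      (auto intro: order_trans[OF diff_left_mono[OF measure_nonneg]] simp: measure_pmf.prob_le_1)
qed simp

lemma tv_dist_leI: "(\<And>S. measure_pmf.prob p S - measure_pmf.prob q S \<le> e) \<Longrightarrow> tv_dist p q \<le> e"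
  unfolding tv_dist_def by (rule cSUP_least) auto

lemma tv_dist_commute: "tv_dist p q = tv_dist q p"
proof -
  have "tv_dist p q \<le> tv_dist q p" for p q :: "'a pmf"
  proof (rule tv_dist_leI)
    fix S
    have "measure_pmf.prob q (- S) - measure_pmf.prob p (- S) \<le> tv_dist q p"
      by (rule prob_diff_le_tv_dist)
    then show "measure_pmf.prob p S - measure_pmf.prob q S \<le> tv_dist q p"
      using measure_pmf.prob_compl[of S p] measure_pmf.prob_compl[of S q] by (simp add: Compl_eq_Diff_UNIV)
  qed
  then show ?thesis by (simp add: antisym)
qed

lemma tv_dist_triangle: "tv_dist p r \<le> tv_dist p q + tv_dist q r"
proof (rule tv_dist_leI)
  fix S
  show "measure_pmf.prob p S - measure_pmf.prob r S \<le> tv_dist p q + tv_dist q r"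
    using prob_diff_le_tv_dist[of p S q] prob_diff_le_tv_dist[of q S r] by linarith
qed

lemma tv_dist_map_le: "tv_dist (map_pmf f p) (map_pmf f q) \<le> tv_dist p q"
  by (rule tv_dist_leI) (simp add: prob_diff_le_tv_dist)

lemma tv_dist_refl: "tv_dist p p = 0"
  using prob_diff_le_tv_dist[of p "{}" p] tv_dist_leI[of p p 0] by simp

text \<open>Here \<open>t\<close> plays the role of a density. For t \<le> 1 put u = 1 - sqrt t:
  then 1 - t \<le> 2u, the logarithmic defect is at least u^2, and 2u \<le> l + u^2 / l. For t > 1
  the left side is negative.\<close>

lemma one_minus_le_log_defect:
  fixes t l :: real
  assumes "0 < t" "0 < l"
  shows "1 - t \<le> l + (t - 1 - ln t) / l"
proof (cases "t \<le> 1")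
  case True
  have "ln t = 2 * ln (sqrt t)"
    using assms by (simp add: ln_sqrt)
  also have "\<dots> \<le> 2 * (sqrt t - 1)"
    using assms ln_le_minus_one[of "sqrt t"] by simp
  finally have "(1 - sqrt t)\<^sup>2 \<le> t - 1 - ln t"
    using assms by (simp add: power2_diff)
  moreover have "1 - t \<le> 2 * (1 - sqrt t)"
  proof -
    have "(1 - sqrt t)\<^sup>2 \<ge> 0" by simp
    then show ?thesis using assms by (simp add: power2_diff)
  qed
  moreover have "2 * (1 - sqrt t) \<le> l + (1 - sqrt t)\<^sup>2 / l"
  proof -
    have "(l - (1 - sqrt t))\<^sup>2 \<ge> 0" by simp
    then have "2 * (1 - sqrt t) * l \<le> l * l + (1 - sqrt t)\<^sup>2"
      by (simp add: power2_eq_square algebra_simps)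
    then show ?thesis using assms by (simp add: field_simps power2_eq_square)
  qed
  ultimately show ?thesis
    using assms by (smt (verit) divide_right_mono)
next
  case False
  have "0 \<le> t - 1 - ln t" using ln_le_minus_one[of t] assms by simp
  then show ?thesis using False assms by (smt (verit) divide_nonneg_pos)
qed

text \<open>A form of Pinsker's inequality without the square root: optimise over \<open>l\<close>.\<close>
lemma tv_dist_le_relative_entropy:
  assumes fin: "finite (set_pmf p)" and sub: "set_pmf p \<subseteq> set_pmf q" and l: "0 < l"
  shows "tv_dist p q \<le> l + (\<Sum>x\<in>set_pmf p. pmf p x * ln (pmf p x / pmf q x)) / l"
proof (rule tv_dist_leI)
  fix S
  let ?t = "\<lambda>x. pmf q x / pmf p x"
  let ?g = "\<lambda>x. l + (?t x - 1 - ln (?t x)) / l"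
  have g: "pmf p x - pmf q x \<le> pmf p x * ?g x \<and> 0 \<le> pmf p x * ?g x" if "x \<in> set_pmf p" for x
  proof -
    have pos: "0 < pmf p x" "0 < pmf q x" using that sub by (auto simp: pmf_positive)
    have "1 - ?t x \<le> ?g x" using pos l by (intro one_minus_le_log_defect) auto
    then have "pmf p x * (1 - ?t x) \<le> pmf p x * ?g x" using pos by (intro mult_left_mono) auto
    moreover have "0 \<le> ?t x - 1 - ln (?t x)"
      using ln_le_minus_one[of "?t x"] pos by simp
    then have "0 \<le> ?g x" using l by simp
    ultimately show ?thesis using pos by (simp add: right_diff_distrib)
  qed
  have "measure_pmf.prob p S - measure_pmf.prob q S
      \<le> measure_pmf.prob p (S \<inter> set_pmf p) - measure_pmf.prob q (S \<inter> set_pmf p)"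
    using measure_pmf.finite_measure_mono[of "S \<inter> set_pmf p" S q] by (simp add: measure_Int_set_pmf)
  also have "\<dots> = (\<Sum>x\<in>S \<inter> set_pmf p. pmf p x - pmf q x)"
    using fin by (simp add: measure_measure_pmf_finite sum_subtractf)
  also have "\<dots> \<le> (\<Sum>x\<in>S \<inter> set_pmf p. pmf p x * ?g x)"
    by (intro sum_mono) (use g in auto)
  also have "\<dots> \<le> (\<Sum>x\<in>set_pmf p. pmf p x * ?g x)"
    by (intro sum_mono2) (use g fin in auto)
  also have "\<dots> = (\<Sum>x\<in>set_pmf p. l * pmf p x + pmf q x / l - pmf p x / l + pmf p x * ln (pmf p x / pmf q x) / l)"
  proof (rule sum.cong[OF refl])
    fix x assume "x \<in> set_pmf p"
    then have pos: "0 < pmf p x" "0 < pmf q x" using sub by (auto simp: pmf_positive)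
    then show "pmf p x * ?g x = l * pmf p x + pmf q x / l - pmf p x / l + pmf p x * ln (pmf p x / pmf q x) / l"
      using l by (simp add: ln_div field_simps)
  qed
  also have "\<dots> = l + (\<Sum>x\<in>set_pmf p. pmf q x) / l - 1 / l + (\<Sum>x\<in>set_pmf p. pmf p x * ln (pmf p x / pmf q x)) / l"
    using fin by (simp add: sum.distrib sum_subtractf sum_distrib_left[symmetric] sum_divide_distrib[symmetric] sum_pmf_eq_1)
  \<comment> \<open>The part t - 1 of the defect has mean q(supp p) - 1 \<le> 0; only the relative
    entropy is left.\<close>
  also have "\<dots> \<le> l + (\<Sum>x\<in>set_pmf p. pmf p x * ln (pmf p x / pmf q x)) / l"
    using l sum_pmf_subset_le_1[OF fin, of q] by (simp add: divide_right_mono)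
  finally show "measure_pmf.prob p S - measure_pmf.prob q S \<le> \<dots>" .
qed

text \<open>The mean over x of the relative entropy of x - Y with respect to X - Y is exactly H(X -
  Y) - H(Y). The bound with the parameter \<open>l\<close> is linear in the relative entropy, so it
  averages without a convexity argument.\<close>

lemma average_tv_dist_pmf_diff:
  fixes p q :: "'a::ab_group_add pmf"
  assumes fin: "finite (set_pmf p)" "finite (set_pmf q)" and l: "0 < l"
  shows "(\<Sum>x\<in>set_pmf p. pmf p x * tv_dist (map_pmf (\<lambda>y. x - y) q) (pmf_diff p q))
    \<le> l + (shannon_entropy (pmf_diff p q) - shannon_entropy q) / l"
proof -
  let ?r = "pmf_diff p q" and ?N = "\<lambda>x. map_pmf (\<lambda>y. x - y) q"
  have inj: "inj_on (\<lambda>y. x - y) B" for x :: 'a and B by (simp add: inj_on_def)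
  have KL: "(\<Sum>z\<in>set_pmf (?N x). pmf (?N x) z * ln (pmf (?N x) z / pmf ?r z))
      = (\<Sum>y\<in>set_pmf q. pmf q y * ln (1 / pmf ?r (x - y))) - shannon_entropy q"
    if x: "x \<in> set_pmf p" for x
  proof -
    have "(\<Sum>z\<in>set_pmf (?N x). pmf (?N x) z * ln (pmf (?N x) z / pmf ?r z))
      = (\<Sum>y\<in>set_pmf q. pmf q y * ln (pmf q y / pmf ?r (x - y)))"
      using fin by (subst sum_map_pmf) (auto simp: pmf_map_inj[OF inj])
    also have "\<dots> = (\<Sum>y\<in>set_pmf q. pmf q y * ln (1 / pmf ?r (x - y)) - pmf q y * ln (1 / pmf q y))"
    proof (rule sum.cong[OF refl])
      fix y assume y: "y \<in> set_pmf q"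
      have "0 < pmf ?r (x - y)"
        using pmf_map_pos[of "(x, y)" "pair_pmf p q" "\<lambda>(x, y). x - y"] x y by (simp add: pmf_diff_def)
      then show "pmf q y * ln (pmf q y / pmf ?r (x - y)) = pmf q y * ln (1 / pmf ?r (x - y)) - pmf q y * ln (1 / pmf q y)"
        using y by (simp add: ln_div pmf_positive algebra_simps)
    qed
    finally show ?thesis by (simp add: sum_subtractf shannon_entropy_def)
  qed
  have "(\<Sum>x\<in>set_pmf p. pmf p x * tv_dist (?N x) ?r)
     \<le> (\<Sum>x\<in>set_pmf p. pmf p x * (l + ((\<Sum>y\<in>set_pmf q. pmf q y * ln (1 / pmf ?r (x - y))) - shannon_entropy q) / l))"
  proof (intro sum_mono mult_left_mono)
    fix x assume x: "x \<in> set_pmf p"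
    have "set_pmf (?N x) \<subseteq> set_pmf ?r" using x by (auto simp: pmf_diff_def image_iff)
    then show "tv_dist (?N x) ?r \<le> l + ((\<Sum>y\<in>set_pmf q. pmf q y * ln (1 / pmf ?r (x - y))) - shannon_entropy q) / l"
      using tv_dist_le_relative_entropy[of "?N x" ?r l] fin l KL[OF x] by simp
  qed simp
  also have "\<dots> = (\<Sum>x\<in>set_pmf p. pmf p x * l + (pmf p x * (\<Sum>y\<in>set_pmf q. pmf q y * ln (1 / pmf ?r (x - y)))) / l
       - pmf p x * (shannon_entropy q / l))"
    by (simp add: diff_divide_distrib algebra_simps)
  also have "\<dots> = l + (\<Sum>x\<in>set_pmf p. pmf p x * (\<Sum>y\<in>set_pmf q. pmf q y * ln (1 / pmf ?r (x - y)))) / l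
       - shannon_entropy q / l"
    using fin by (simp add: sum.distrib sum_subtractf sum_distrib_right[symmetric] sum_divide_distrib[symmetric] sum_pmf_eq_1)
  also have "(\<Sum>x\<in>set_pmf p. pmf p x * (\<Sum>y\<in>set_pmf q. pmf q y * ln (1 / pmf ?r (x - y)))) = shannon_entropy ?r"
    unfolding pmf_diff_def using fin
    by (subst shannon_entropy_map_pmf) (simp_all add: sum.cartesian_product' pmf_pair sum_distrib_left mult.assoc)
  finally show ?thesis by (simp add: diff_divide_distrib)
qed

text \<open>Two translates \<open>x - q\<close> and \<open>x' - q\<close> are both close to the law of the difference.\<close>
lemma average_tv_dist_translate:
  fixes p q :: "'a::ab_group_add pmf"
  assumes fin: "finite (set_pmf p)" "finite (set_pmf q)" and l: "0 < l"
  shows "(\<Sum>x\<in>set_pmf p. \<Sum>x'\<in>set_pmf p. pmf p x * pmf p x' * tv_dist q (map_pmf (\<lambda>y. y + (x - x')) q))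
    \<le> 2 * (l + (shannon_entropy (pmf_diff p q) - shannon_entropy q) / l)"
proof -
  let ?r = "pmf_diff p q" and ?N = "\<lambda>x. map_pmf (\<lambda>y. x - y) q"
  define T where "T x = tv_dist (?N x) ?r" for x
  have le: "tv_dist q (map_pmf (\<lambda>y. y + (x - x')) q) \<le> T x + T x'" for x x'
  proof -
    \<comment> \<open>The reflection z -> x - z turns the two translates of -q into \<open>q\<close>
      and its shift by x - x'.\<close>
    have "map_pmf (\<lambda>z. x - z) (?N x) = q" "map_pmf (\<lambda>z. x - z) (?N x') = map_pmf (\<lambda>y. y + (x - x')) q"
      by (simp_all add: pmf.map_comp o_def algebra_simps)
    then have "tv_dist q (map_pmf (\<lambda>y. y + (x - x')) q) \<le> tv_dist (?N x) (?N x')"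
      by (metis tv_dist_map_le)
    also have "\<dots> \<le> T x + T x'"
      using tv_dist_triangle[of "?N x" "?N x'" ?r] tv_dist_commute[of ?r "?N x'"] by (simp add: T_def)
    finally show ?thesis .
  qed
  have "(\<Sum>x\<in>set_pmf p. \<Sum>x'\<in>set_pmf p. pmf p x * pmf p x' * tv_dist q (map_pmf (\<lambda>y. y + (x - x')) q))
    \<le> (\<Sum>x\<in>set_pmf p. \<Sum>x'\<in>set_pmf p. pmf p x * pmf p x' * (T x + T x'))"
    by (intro sum_mono mult_left_mono le) simp
  also have "\<dots> = (\<Sum>x\<in>set_pmf p. pmf p x * T x) * (\<Sum>x\<in>set_pmf p. pmf p x)
      + (\<Sum>x\<in>set_pmf p. pmf p x) * (\<Sum>x\<in>set_pmf p. pmf p x * T x)"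
    unfolding sum_product sum.distrib[symmetric] by (simp add: algebra_simps)
  also have "\<dots> = 2 * (\<Sum>x\<in>set_pmf p. pmf p x * T x)"
    using fin by (simp add: sum_pmf_eq_1)
  also have "\<dots> \<le> 2 * (l + (shannon_entropy ?r - shannon_entropy q) / l)"
    using mult_left_mono[OF average_tv_dist_pmf_diff[OF fin l], of 2] by (simp only: T_def)
  finally show ?thesis .
qed

lemma tv_dist_translate_multiple:
  fixes q :: "int pmf"
  shows "tv_dist q (map_pmf (\<lambda>y. y + int j * h) q) \<le> real j * tv_dist q (map_pmf (\<lambda>y. y + h) q)"
proof (induction j)
  case (Suc j)
  let ?s = "\<lambda>k. map_pmf (\<lambda>y. y + k) q"
  have "tv_dist (?s h) (?s (int (Suc j) * h)) \<le> tv_dist q (?s (int j * h))"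
    using tv_dist_map_le[of "\<lambda>y. y + h" q "?s (int j * h)"] by (simp add: pmf.map_comp o_def algebra_simps)
  then have "tv_dist q (?s (int (Suc j) * h)) \<le> tv_dist q (?s h) + tv_dist q (?s (int j * h))"
    using tv_dist_triangle[of q "?s (int (Suc j) * h)" "?s h"] by linarith
  also have "\<dots> \<le> real (Suc j) * tv_dist q (?s h)"
    using Suc.IH by (simp add: algebra_simps)
  finally show ?case .
qed (simp add: tv_dist_refl)

text \<open>The translates of an interval of radius \<open>\<bar>h\<bar>\<close> by multiples of \<open>3 * h\<close> are disjoint, and have
  almost the same probability if \<open>q\<close> is almost invariant under translation by \<open>h\<close>.\<close>
lemma prob_interval_le:
  fixes q :: "int pmf" and c h :: int
  assumes h: "h \<noteq> 0" and k: "0 < k"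
  shows "measure_pmf.prob q {y. \<bar>y - c\<bar> \<le> \<bar>h\<bar>} \<le> 1 / real k + 3 * real k * tv_dist q (map_pmf (\<lambda>y. y + h) q)"
proof -
  let ?S = "\<lambda>j. {y. \<bar>y - (c + int (3 * j) * h)\<bar> \<le> \<bar>h\<bar>}"
  let ?e = "tv_dist q (map_pmf (\<lambda>y. y + h) q)"
  have e: "0 \<le> ?e" using prob_diff_le_tv_dist[of q "{}"] by simp
  have disj: "disjoint_family_on ?S {..<k}"
  proof (unfold disjoint_family_on_def, intro ballI impI)
    fix i j :: nat assume "i \<noteq> j"
    show "?S i \<inter> ?S j = {}"
    proof (rule ccontr)
      assume "?S i \<inter> ?S j \<noteq> {}"
      then obtain y where "\<bar>y - (c + int (3 * i) * h)\<bar> \<le> \<bar>h\<bar>" "\<bar>y - (c + int (3 * j) * h)\<bar> \<le> \<bar>h\<bar>"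
        by blast
      then have "\<bar>int (3 * i) * h - int (3 * j) * h\<bar> \<le> 2 * \<bar>h\<bar>" by linarith
      moreover have "\<bar>int (3 * i) * h - int (3 * j) * h\<bar> = 3 * \<bar>int i - int j\<bar> * \<bar>h\<bar>"
      proof -
        have "int (3 * i) * h - int (3 * j) * h = 3 * ((int i - int j) * h)"
          by (simp add: algebra_simps)
        then show ?thesis by (simp add: abs_mult)
      qed
      moreover have "1 * \<bar>h\<bar> \<le> \<bar>int i - int j\<bar> * \<bar>h\<bar>"
        using \<open>i \<noteq> j\<close> by (intro mult_right_mono) auto
      ultimately show False using h by linarith
    qed
  qed
  \<comment> \<open>The j-th copy is reached from the interval at \<open>c\<close> by 3j shifts by
    \<open>h\<close>, each of which costs at most \<open>?e\<close>.\<close>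
  have "measure_pmf.prob q (?S 0) \<le> measure_pmf.prob q (?S j) + 3 * real k * ?e" if "j < k" for j
  proof -
    have "measure_pmf.prob q (?S 0) = measure_pmf.prob (map_pmf (\<lambda>y. y + int (3 * j) * h) q) (?S j)"
      by (simp add: vimage_def algebra_simps)
    also have "\<dots> \<le> measure_pmf.prob q (?S j) + tv_dist q (map_pmf (\<lambda>y. y + int (3 * j) * h) q)"
      using prob_diff_le_tv_dist[of "map_pmf (\<lambda>y. y + int (3 * j) * h) q" "?S j" q]
      by (simp only: tv_dist_commute[of q] diff_le_eq add.commute[of "tv_dist _ _"])
    also have "tv_dist q (map_pmf (\<lambda>y. y + int (3 * j) * h) q) \<le> real (3 * j) * ?e"
      by (rule tv_dist_translate_multiple)
    also have "\<dots> \<le> 3 * real k * ?e"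
      using that e by (intro mult_right_mono) auto
    finally show ?thesis by simp
  qed
  then have "(\<Sum>j<k. measure_pmf.prob q (?S 0)) \<le> (\<Sum>j<k. measure_pmf.prob q (?S j) + 3 * real k * ?e)"
    by (intro sum_mono) simp
  also have "\<dots> = measure_pmf.prob q (\<Union>j<k. ?S j) + real k * (3 * real k * ?e)"
    using disj by (simp add: sum.distrib measure_pmf.finite_measure_finite_Union)
  also have "\<dots> \<le> 1 + real k * (3 * real k * ?e)"
    by (simp add: measure_pmf.prob_le_1)
  finally show ?thesis
    using k by (simp add: field_simps)
qed

section \<open>Integer-valued variables at small distance\<close>

text \<open>The pair (x - y, y) determines (x, y), so H(X) + H(Y) \<le> H(X - Y) + H(Y) by
  subadditivity, which is submodularity with a constant middle variable.\<close>

lemma shannon_entropy_pmf_diff_ge: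
  assumes fin: "finite (set_pmf p)" "finite (set_pmf q)"
  shows "shannon_entropy p \<le> shannon_entropy (pmf_diff p q)"
proof -
  let ?w = "pair_pmf p q" and ?Z = "\<lambda>(x, y). x - y"
  have "shannon_entropy (map_pmf (\<lambda>w. (?Z w, (), snd w)) ?w) + shannon_entropy (map_pmf (\<lambda>w. ()) ?w)
    \<le> shannon_entropy (map_pmf (\<lambda>w. (?Z w, ())) ?w) + shannon_entropy (map_pmf (\<lambda>w. ((), snd w)) ?w)"
    using fin by (intro shannon_entropy_submodular) simp
  moreover have "shannon_entropy (map_pmf (\<lambda>w. (?Z w, (), snd w)) ?w) = shannon_entropy p + shannon_entropy q"
    by (subst shannon_entropy_map_inj) (auto simp: inj_on_def shannon_entropy_pair_pmf[OF fin])
  moreover have "shannon_entropy (map_pmf (\<lambda>w. (?Z w, ())) ?w) = shannon_entropy (pmf_diff p q)"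
  proof -
    have "map_pmf (\<lambda>w. (?Z w, ())) ?w = map_pmf (\<lambda>z. (z, ())) (pmf_diff p q)"
      by (simp add: pmf_diff_def pmf.map_comp o_def)
    then show ?thesis by (simp add: shannon_entropy_map_inj inj_on_def)
  qed
  moreover have "shannon_entropy (map_pmf (\<lambda>w. ((), snd w)) ?w) = shannon_entropy q"
  proof -
    have "map_pmf (\<lambda>w. ((), snd w)) ?w = map_pmf (Pair ()) (map_pmf snd ?w)"
      by (simp only: pmf.map_comp o_def)
    then show ?thesis by (simp add: map_snd_pair_pmf shannon_entropy_map_inj inj_on_def)
  qed
  ultimately show ?thesis
    using shannon_entropy_nonneg[of "map_pmf (\<lambda>w. ()) ?w"] by linarith
qed

text \<open>Twice the distance is the sum of H(X - Y) - H(X) and H(X - Y) - H(Y), and both are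
  nonnegative.\<close>

lemma shannon_entropy_pmf_diff_le:
  assumes fin: "finite (set_pmf p)" "finite (set_pmf q)"
  shows "shannon_entropy (pmf_diff p q) - shannon_entropy q \<le> 2 * ent_dist p q"
  using shannon_entropy_pmf_diff_ge[OF fin] by (simp add: ent_dist_alt)

lemma ent_dist_nonneg:
  assumes fin: "finite (set_pmf p)" "finite (set_pmf q)"
  shows "0 \<le> ent_dist p q"
  using shannon_entropy_pmf_diff_ge[OF fin] shannon_entropy_pmf_diff_ge[OF fin(2,1)] ent_dist_commute[of p q]
  by (simp add: ent_dist_alt)

section \<open>Comparing the differences of independent copies\<close>

lemma prob_eq_sum:
  "finite (set_pmf p) \<Longrightarrow> measure_pmf.prob p S = (\<Sum>x\<in>set_pmf p. pmf p x * of_bool (x \<in> S))"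
  using measure_measure_pmf_finite[of "set_pmf p \<inter> S" p] measure_Int_set_pmf[of p S]
  by (simp add: Int_commute[of S] sum.inter_restrict of_bool_def if_distrib cong: if_cong)

text \<open>For fixed x \<noteq> x' and y' the event says that y lies in the interval of radius
  \<bar>x - x'\<bar> about y'. Such an interval has small mass when \<open>q\<close> is almost
  invariant under x - x', which holds on average over x and x'.\<close>

lemma prob_dominating_differences_le:
  fixes p q :: "int pmf"
  assumes fin: "finite (set_pmf p)" "finite (set_pmf q)" and k: "0 < k" and l: "0 < l"
  shows "measure_pmf.prob (pair_pmf (pair_pmf p p) (pair_pmf q q))
      {((x, x'), (y', y)). x \<noteq> x' \<and> \<bar>y - y'\<bar> \<le> \<bar>x - x'\<bar>}
    \<le> 1 / real k + 6 * real k * (l + 2 * ent_dist p q / l)" (is "measure_pmf.prob ?w ?S \<le> _")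
proof -
  let ?P = "set_pmf p" and ?Q = "set_pmf q"
  let ?tv = "\<lambda>h. tv_dist q (map_pmf (\<lambda>y. y + h) q)"
  have tv: "0 \<le> ?tv h" for h using prob_diff_le_tv_dist[of q "{}"] by simp
  have inner: "(\<Sum>y\<in>?Q. pmf q y * of_bool (x \<noteq> x' \<and> \<bar>y - y'\<bar> \<le> \<bar>x - x'\<bar>))
      \<le> 1 / real k + 3 * real k * ?tv (x - x')" for x x' y'
  proof (cases "x = x'")
    case False
    then show ?thesis
      using prob_interval_le[of "x - x'" k q y'] k prob_eq_sum[OF fin(2), of "{y. \<bar>y - y'\<bar> \<le> \<bar>x - x'\<bar>}"]
      by simp
  next
    case True
    then show ?thesis using k tv[of 0] by simp
  qed
  have "measure_pmf.prob ?w ?S = (\<Sum>x\<in>?P. \<Sum>x'\<in>?P. \<Sum>y'\<in>?Q.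
      pmf p x * pmf p x' * (pmf q y' * (\<Sum>y\<in>?Q. pmf q y * of_bool (x \<noteq> x' \<and> \<bar>y - y'\<bar> \<le> \<bar>x - x'\<bar>))))"
    using fin by (subst prob_eq_sum)
      (simp_all add: sum.cartesian_product' pmf_pair sum_distrib_left mult_ac del: sum_mult_of_bool_eq)
  also have "\<dots> \<le> (\<Sum>x\<in>?P. \<Sum>x'\<in>?P. \<Sum>y'\<in>?Q.
      pmf p x * pmf p x' * (pmf q y' * (1 / real k + 3 * real k * ?tv (x - x'))))"
    by (intro sum_mono mult_left_mono inner) auto
  also have "\<dots> = (\<Sum>x\<in>?P. \<Sum>x'\<in>?P. pmf p x * pmf p x' * (1 / real k + 3 * real k * ?tv (x - x')))"
    using fin by (simp add: sum_distrib_left[symmetric] sum_distrib_right[symmetric] sum_pmf_eq_1)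
  also have "\<dots> = (\<Sum>x\<in>?P. \<Sum>x'\<in>?P. pmf p x * pmf p x') * (1 / real k)
      + 3 * real k * (\<Sum>x\<in>?P. \<Sum>x'\<in>?P. pmf p x * pmf p x' * ?tv (x - x'))"
    by (simp add: sum_distrib_left sum_distrib_right sum.distrib[symmetric] algebra_simps)
  also have "(\<Sum>x\<in>?P. \<Sum>x'\<in>?P. pmf p x * pmf p x') = 1"
    using fin by (simp add: sum_distrib_left[symmetric] sum_pmf_eq_1)
  also have "3 * real k * (\<Sum>x\<in>?P. \<Sum>x'\<in>?P. pmf p x * pmf p x' * ?tv (x - x'))
      \<le> 3 * real k * (2 * (l + 2 * ent_dist p q / l))"
  proof (intro mult_left_mono)
    have "(shannon_entropy (pmf_diff p q) - shannon_entropy q) / l \<le> 2 * ent_dist p q / l"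
      using shannon_entropy_pmf_diff_le[OF fin] l by (intro divide_right_mono) auto
    then show "(\<Sum>x\<in>?P. \<Sum>x'\<in>?P. pmf p x * pmf p x' * ?tv (x - x')) \<le> 2 * (l + 2 * ent_dist p q / l)"
      by (intro order_trans[OF average_tv_dist_translate[OF fin l]] mult_left_mono add_left_mono) auto
  qed simp
  also have "3 * real k * (2 * (l + 2 * ent_dist p q / l)) = 6 * real k * (l + 2 * ent_dist p q / l)"
    by simp
  finally show ?thesis by simp
qed

text \<open>The collision probability is the mean of \<open>pmf p\<close> under \<open>p\<close>,
  hence at most its maximum.\<close>

lemma prob_coincidence_le_atom:
  assumes fin: "finite (set_pmf p)"
  shows "\<exists>x0. measure_pmf.prob (pair_pmf p p) {(x, x'). x = x'} \<le> pmf p x0"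
proof -
  have "Max (pmf p ` set_pmf p) \<in> pmf p ` set_pmf p"
    using fin set_pmf_not_empty[of p] by (intro Max_in) auto
  then obtain x0 where x0: "pmf p x0 = Max (pmf p ` set_pmf p)" by force
  have "measure_pmf.prob (pair_pmf p p) {(x, x'). x = x'} = (\<Sum>x\<in>set_pmf p. \<Sum>x'\<in>set_pmf p. if x = x' then pmf p x * pmf p x' else 0)"
    using fin by (subst prob_eq_sum) (auto simp: sum.cartesian_product' pmf_pair intro!: sum.cong)
  also have "\<dots> = (\<Sum>x\<in>set_pmf p. pmf p x * pmf p x)"
    using fin by simp
  also have "\<dots> \<le> (\<Sum>x\<in>set_pmf p. pmf p x * pmf p x0)"
    unfolding x0 using fin by (intro sum_mono mult_left_mono Max_ge) auto
  also have "\<dots> = pmf p x0"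
    using fin by (simp add: sum_distrib_right[symmetric] sum_pmf_eq_1)
  finally show ?thesis by blast
qed

text \<open>Of two differences \<open>x - x'\<close> and \<open>y - y'\<close> that do not both vanish, the one with the larger
  absolute value is nonzero; neither is likely to be dominated by the other.\<close>
lemma atoms_of_small_ent_dist:
  fixes p q :: "int pmf"
  assumes fin: "finite (set_pmf p)" "finite (set_pmf q)" and k: "0 < k" and l: "0 < l"
  defines "\<theta> \<equiv> 1 / real k + 6 * real k * (l + 2 * ent_dist p q / l)"
  shows "\<exists>x0 y0. 1 - 2 * \<theta> \<le> pmf p x0 \<and> 1 - 2 * \<theta> \<le> pmf q y0"
proof -
  let ?w = "pair_pmf (pair_pmf p p) (pair_pmf q q)"
  let ?S = "{((x, x'), (y', y)). x \<noteq> x' \<and> \<bar>y - y'\<bar> \<le> \<bar>x - x'\<bar>} :: ((int \<times> int) \<times> (int \<times> int)) set"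
  let ?T = "{((x, x'), (y', y)). y \<noteq> y' \<and> \<bar>x - x'\<bar> \<le> \<bar>y - y'\<bar>} :: ((int \<times> int) \<times> (int \<times> int)) set"
  let ?E = "{((x, x'), (y', y)). x = x' \<and> y' = y} :: ((int \<times> int) \<times> (int \<times> int)) set"
  have S: "measure_pmf.prob ?w ?S \<le> \<theta>"
    unfolding \<theta>_def by (rule prob_dominating_differences_le[OF fin k l])
  have T: "measure_pmf.prob ?w ?T \<le> \<theta>"
  proof -
    have "measure_pmf.prob ?w ?T = measure_pmf.prob (pair_pmf (pair_pmf q q) (pair_pmf p p)) ((\<lambda>(a, b). (b, a)) -` ?T)"
      by (subst pair_commute_pmf) simp
    also have "(\<lambda>(a, b). (b, a)) -` ?T = ?S"
      by (auto simp: abs_minus_commute)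
    also have "measure_pmf.prob (pair_pmf (pair_pmf q q) (pair_pmf p p)) ?S \<le> \<theta>"
      unfolding \<theta>_def using prob_dominating_differences_le[OF fin(2,1) k l] by (simp add: ent_dist_commute)
    finally show ?thesis .
  qed
  \<comment> \<open>Either both differences vanish, or the larger one in absolute value is nonzero;
    in case of a tie \<open>?S\<close> and \<open>?T\<close> may both occur.\<close>
  have "1 = measure_pmf.prob ?w (?S \<union> ?T \<union> ?E)"
    by (subst measure_pmf.prob_eq_1[THEN iffD2]) auto
  also have "\<dots> \<le> measure_pmf.prob ?w ?S + measure_pmf.prob ?w ?T + measure_pmf.prob ?w ?E"
    using measure_Un_le[of "?S \<union> ?T" ?w ?E] measure_Un_le[of ?S ?w ?T] by simp
  finally have E: "1 - 2 * \<theta> \<le> measure_pmf.prob ?w ?E" using S T by linarith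
  have "measure_pmf.prob ?w ?E \<le> measure_pmf.prob (map_pmf fst ?w) {(x, x'). x = x'}"
    unfolding measure_map_pmf by (rule measure_pmf.finite_measure_mono) auto
  moreover have "measure_pmf.prob ?w ?E \<le> measure_pmf.prob (map_pmf snd ?w) {(x, x'). x = x'}"
    unfolding measure_map_pmf by (rule measure_pmf.finite_measure_mono) auto
  ultimately show ?thesis
    using E prob_coincidence_le_atom[OF fin(1)] prob_coincidence_le_atom[OF fin(2)]
    unfolding map_fst_pair_pmf map_snd_pair_pmf by (meson order_trans)
qed

section \<open>Variables with an atom of mass close to 1\<close>

lemma pmf_add_le_1: "x \<noteq> y \<Longrightarrow> pmf p x + pmf p y \<le> 1"
  using sum_pmf_subset_le_1[of "{x, y}" p] by simp

lemma sum_pmf_neq: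
  assumes "finite (set_pmf p)"
  shows "(\<Sum>x\<in>set_pmf p. pmf p x * of_bool (x \<noteq> x0)) = 1 - pmf p x0"
  using prob_eq_sum[OF assms, of "- {x0}"] measure_pmf.prob_compl[of "{x0}" p]
  by (simp add: Compl_eq_Diff_UNIV pmf.rep_eq)

text \<open>Every other point has mass at most exp (-L), so it contributes at least \<open>L\<close>
  times its mass to the entropy.\<close>

lemma shannon_entropy_ge_off_atom:
  assumes fin: "finite (set_pmf p)" and atom: "1 - exp (- L) \<le> pmf p x0"
  shows "L * (1 - pmf p x0) \<le> shannon_entropy p"
proof -
  have "L * (1 - pmf p x0) = (\<Sum>x\<in>set_pmf p. pmf p x * (L * of_bool (x \<noteq> x0)))"
    by (simp add: sum_pmf_neq[OF fin, symmetric] sum_distrib_left mult_ac)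
  also have "\<dots> \<le> shannon_entropy p"
    unfolding shannon_entropy_def
  proof (intro sum_mono mult_left_mono)
    fix x assume x: "x \<in> set_pmf p"
    show "L * of_bool (x \<noteq> x0) \<le> ln (1 / pmf p x)"
    proof (cases "x = x0")
      case False
      then have "pmf p x \<le> exp (- L)" using pmf_add_le_1[of x x0 p] atom by simp
      then have "ln (pmf p x) \<le> ln (exp (- L))" using x by (intro ln_mono) (simp_all add: pmf_positive)
      moreover have "ln (1 / pmf p x) = - ln (pmf p x)"
        using x pmf_positive[of x p] by (simp add: ln_div)
      ultimately show ?thesis using False by simp
    qed (use x in \<open>simp add: pmf_le_1 pmf_positive\<close>)
  qed simp
  finally show ?thesis .
qed

lemma shannon_entropy_eq_0: "pmf p x0 = 1 \<Longrightarrow> shannon_entropy p = 0"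
  using pmf_add_le_1[of _ x0 p] pmf_positive[of _ p]
  unfolding shannon_entropy_def
  by (intro sum.neutral) (metis add_le_same_cancel2 div_by_1 leD ln_one mult_zero_right)

text \<open>The kernel guesses \<open>x\<close> from \<open>z = x - y\<close>: if \<open>z = x0 - y0\<close> then almost surely \<open>x = x0\<close>, and
  otherwise most likely \<open>x = x0\<close> or \<open>y = y0\<close>. The weight \<open>\<tau>\<close> on the blind guess \<open>p\<close> is chosen
  comparable to the probability that one of the atoms is missed.\<close>
definition guess_kernel :: "'a::ab_group_add pmf \<Rightarrow> 'a \<Rightarrow> 'a \<Rightarrow> real \<Rightarrow> 'a \<Rightarrow> 'a \<Rightarrow> real" where
  "guess_kernel p x0 y0 \<tau> z x =
    (if z = x0 - y0 then (1 - \<tau>) * of_bool (x = x0) + \<tau> * pmf p x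
     else (of_bool (x = z + y0) + of_bool (x = x0) + pmf p x) / 3)"

lemma sum_guess_kernel_le_1:
  assumes fin: "finite (set_pmf p)" and \<tau>: "\<tau> \<le> 1"
  shows "(\<Sum>x\<in>set_pmf p. guess_kernel p x0 y0 \<tau> z x) \<le> 1"
proof -
  have d: "(\<Sum>x\<in>set_pmf p. of_bool (x = c)) \<le> (1::real)" for c
    using fin by (simp add: of_bool_def)
  show ?thesis
  proof (cases "z = x0 - y0")
    case True
    then show ?thesis
      using fin mult_left_mono[OF d[of x0], of "1 - \<tau>"] \<tau>
      by (simp add: guess_kernel_def sum.distrib sum_distrib_left[symmetric] sum_pmf_eq_1)
  next
    case False
    then show ?thesis
      using fin d[of x0] d[of "z + y0"]
      by (simp add: guess_kernel_def sum.distrib sum_divide_distrib[symmetric] sum_pmf_eq_1)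
  qed
qed

text \<open>The code length of \<open>x\<close> given x - y: about \<tau> if both atoms are hit, at
  most ln 3 if exactly one is missed, and ln (1 / \<tau>) + ln (1 / p(x)) if both are. The cases are
  merged into one expression in the two indicators of a miss, whose mean factorises by
  independence.\<close>

lemma ln_guess_kernel_le:
  assumes x: "x \<in> set_pmf p" and \<tau>: "0 < \<tau>" "\<tau> \<le> 1 / 3"
  shows "0 < guess_kernel p x0 y0 \<tau> (x - y) x"
    and "ln (1 / guess_kernel p x0 y0 \<tau> (x - y) x)
      \<le> 2 * \<tau> + 2 * of_bool (x \<noteq> x0) + 2 * of_bool (y \<noteq> y0)
        + of_bool (x \<noteq> x0) * of_bool (y \<noteq> y0) / \<tau> + of_bool (y \<noteq> y0) * ln (1 / pmf p x)"
proof -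
  let ?K = "guess_kernel p x0 y0 \<tau> (x - y) x"
  have px: "0 < pmf p x" "pmf p x \<le> 1" using x by (auto simp: pmf_positive pmf_le_1)
  have lp: "0 \<le> ln (1 / pmf p x)" using px by simp
  have ge: "\<tau> * pmf p x \<le> ?K"
  proof -
    have "\<tau> * pmf p x \<le> 1 / 3 * pmf p x" using \<tau> px by (intro mult_right_mono) auto
    moreover have "pmf p x / 3 \<le> ?K" if "x - y \<noteq> x0 - y0"
      using that by (simp add: guess_kernel_def divide_right_mono)
    moreover have "\<tau> * pmf p x \<le> ?K" if "x - y = x0 - y0"
      using that \<tau> by (simp add: guess_kernel_def)
    ultimately show ?thesis by linarith
  qed
  moreover have "0 < \<tau> * pmf p x" using \<tau> px by simp
  ultimately show pos: "0 < ?K" by linarith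
  have mono: "ln (1 / ?K) \<le> ln (1 / m)" if "0 < m" "m \<le> ?K" for m
    using that pos by (simp add: ln_div)
  have three: "ln (1 / (1 / 3)) \<le> (2::real)" using ln_le_minus_one[of "3::real"] by simp
  consider "x = x0" "y = y0" | "x = x0" "y \<noteq> y0" | "x \<noteq> x0" "y = y0" | "x \<noteq> x0" "y \<noteq> y0" by blast
  then show "ln (1 / ?K) \<le> 2 * \<tau> + 2 * of_bool (x \<noteq> x0) + 2 * of_bool (y \<noteq> y0)
        + of_bool (x \<noteq> x0) * of_bool (y \<noteq> y0) / \<tau> + of_bool (y \<noteq> y0) * ln (1 / pmf p x)"
  proof cases
    case 1
    have "ln (1 / ?K) \<le> ln (1 / (1 - \<tau>))"
      using \<tau> px 1 by (intro mono) (auto simp: guess_kernel_def)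
    also have "\<dots> \<le> 1 / (1 - \<tau>) - 1"
      using \<tau> by (intro ln_le_minus_one) auto
    also have "\<dots> \<le> 2 * \<tau>"
    proof -
      have "\<tau> * \<tau> \<le> \<tau> * (1 / 3)" using \<tau> by (intro mult_left_mono) auto
      then show ?thesis using \<tau> by (simp add: field_simps)
    qed
    finally show ?thesis using 1 by simp
  next
    case 2
    have "1 / 3 \<le> ?K" using 2 px by (auto simp: guess_kernel_def)
    then have "ln (1 / ?K) \<le> 2" using mono[of "1 / 3"] three by linarith
    then show ?thesis using 2 \<tau> lp by simp
  next
    case 3
    have "1 / 3 \<le> ?K" using 3 px by (auto simp: guess_kernel_def)
    then have "ln (1 / ?K) \<le> 2" using mono[of "1 / 3"] three by linarith
    then show ?thesis using 3 \<tau> by simp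
  next
    case 4
    have "ln (1 / ?K) \<le> ln (1 / (\<tau> * pmf p x))"
      using ge \<tau> px by (intro mono) auto
    also have "\<dots> = ln (1 / \<tau>) + ln (1 / pmf p x)"
      using \<tau> px by (simp add: ln_div ln_mult)
    \<comment> \<open>This crude bound suffices: it is paid only when both atoms are missed, an
      event of probability at most \<tau>^2.\<close>
    also have "ln (1 / \<tau>) \<le> 1 / \<tau>"
      using ln_le_minus_one[of "1 / \<tau>"] \<tau> by simp
    finally show ?thesis using 4 \<tau> by simp
  qed
qed

text \<open>H(X) + H(Y) = H(X - Y) + H(X | X - Y), and the last term is at most the mean code length
  of the guess. With \<alpha> and \<beta> the miss probabilities, this mean is 2\<tau> + 2\<alpha> +
  2\<beta> + \<alpha>\<beta>/\<tau> + \<beta> H(X), where \<alpha> + \<beta> = \<tau>.\<close>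

lemma shannon_entropy_add_le_pmf_diff:
  assumes fin: "finite (set_pmf p)" "finite (set_pmf q)"
    and \<tau>: "0 < \<tau>" "\<tau> \<le> 1 / 3" "\<tau> = (1 - pmf p x0) + (1 - pmf q y0)"
  shows "shannon_entropy p + shannon_entropy q
    \<le> shannon_entropy (pmf_diff p q) + 5 * \<tau> + (1 - pmf q y0) * shannon_entropy p"
proof -
  let ?P = "set_pmf p" and ?Q = "set_pmf q" and ?r = "pmf_diff p q"
  let ?K = "guess_kernel p x0 y0 \<tau>"
  let ?a = "\<lambda>(x, y). pmf ?r (x - y) * ?K (x - y) x" and ?u = "\<lambda>(x, y). pmf p x * pmf q y"
  have finr: "finite (set_pmf ?r)" using fin by (simp add: pmf_diff_def)
  have rpos: "0 < pmf ?r (x - y)" if "x \<in> ?P" "y \<in> ?Q" for x y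
    using pmf_map_pos[of "(x, y)" "pair_pmf p q" "\<lambda>(x, y). x - y"] that by (simp add: pmf_diff_def)
  have nonneg: "0 \<le> ?K z x" for z x using \<tau> by (simp add: guess_kernel_def)
  \<comment> \<open>As (x, y) is recovered from (x - y, x), the weights \<open>?a\<close> form a
    sub-probability: draw the difference, then guess.\<close>
  have "sum ?a (?P \<times> ?Q) = sum (\<lambda>(z, x). pmf ?r z * ?K z x) ((\<lambda>(x, y). (x - y, x)) ` (?P \<times> ?Q))"
    by (subst sum.reindex) (auto simp: inj_on_def intro!: sum.cong)
  also have "\<dots> \<le> sum (\<lambda>(z, x). pmf ?r z * ?K z x) (set_pmf ?r \<times> ?P)"
    using fin finr nonneg by (intro sum_mono2) (auto simp: pmf_diff_def image_iff intro!: mult_nonneg_nonneg)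
  also have "\<dots> = (\<Sum>z\<in>set_pmf ?r. pmf ?r z * (\<Sum>x\<in>?P. ?K z x))"
    by (simp add: sum.cartesian_product' sum_distrib_left)
  also have "\<dots> \<le> (\<Sum>z\<in>set_pmf ?r. pmf ?r z * 1)"
    using \<tau> fin by (intro sum_mono mult_left_mono sum_guess_kernel_le_1) auto
  also have "\<dots> = sum ?u (?P \<times> ?Q)"
    using fin finr by (simp add: sum_pmf_eq_1 sum.cartesian_product' sum_distrib_left[symmetric])
  finally have "0 \<le> (\<Sum>w\<in>?P \<times> ?Q. ?u w * ln (?u w / ?a w))"
    using fin rpos ln_guess_kernel_le(1)[OF _ \<tau>(1,2)]
    by (intro sum_log_ratio_nonneg) (auto simp: pmf_positive intro!: mult_pos_pos)
  also have "\<dots> = (\<Sum>x\<in>?P. \<Sum>y\<in>?Q. pmf p x * pmf q y * ln (1 / pmf ?r (x - y)) + pmf p x * pmf q y * ln (1 / ?K (x - y) x)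
      - pmf p x * ln (1 / pmf p x) * pmf q y - pmf p x * (pmf q y * ln (1 / pmf q y)))"
    unfolding sum.cartesian_product'
  proof (intro sum.cong refl)
    fix x y assume "x \<in> ?P" "y \<in> ?Q"
    then show "?u (x, y) * ln (?u (x, y) / ?a (x, y)) = pmf p x * pmf q y * ln (1 / pmf ?r (x - y)) + pmf p x * pmf q y * ln (1 / ?K (x - y) x)
      - pmf p x * ln (1 / pmf p x) * pmf q y - pmf p x * (pmf q y * ln (1 / pmf q y))"
      using rpos[of x y] ln_guess_kernel_le(1)[of x p \<tau> x0 y0 y] \<tau>(1,2) pmf_positive[of x p] pmf_positive[of y q]
      by (simp add: ln_div ln_mult algebra_simps)
  qed
  also have "\<dots> = shannon_entropy ?r + (\<Sum>x\<in>?P. \<Sum>y\<in>?Q. pmf p x * pmf q y * ln (1 / ?K (x - y) x))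
      - shannon_entropy p * (\<Sum>y\<in>?Q. pmf q y) - (\<Sum>x\<in>?P. pmf p x) * shannon_entropy q"
  proof -
    have "shannon_entropy ?r = (\<Sum>x\<in>?P. \<Sum>y\<in>?Q. pmf p x * pmf q y * ln (1 / pmf ?r (x - y)))"
      unfolding pmf_diff_def using fin
      by (subst shannon_entropy_map_pmf) (simp_all add: sum.cartesian_product' pmf_pair)
    then show ?thesis
      by (simp only: shannon_entropy_def[of p] shannon_entropy_def[of q] sum_product sum.distrib sum_subtractf)
  qed
  also have "\<dots> = shannon_entropy ?r + (\<Sum>x\<in>?P. \<Sum>y\<in>?Q. pmf p x * pmf q y * ln (1 / ?K (x - y) x))
      - shannon_entropy p - shannon_entropy q"
    using fin by (simp add: sum_pmf_eq_1)
  finally have gibbs: "shannon_entropy p + shannon_entropy q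
     \<le> shannon_entropy ?r + (\<Sum>x\<in>?P. \<Sum>y\<in>?Q. pmf p x * pmf q y * ln (1 / ?K (x - y) x))"
    by linarith
  define \<alpha> where "\<alpha> = 1 - pmf p x0"
  define \<beta> where "\<beta> = 1 - pmf q y0"
  let ?e = "\<lambda>x. of_bool (x \<noteq> x0) :: real" and ?f = "\<lambda>y. of_bool (y \<noteq> y0) :: real"
  have "(\<Sum>x\<in>?P. \<Sum>y\<in>?Q. pmf p x * pmf q y * ln (1 / ?K (x - y) x))
    \<le> (\<Sum>x\<in>?P. \<Sum>y\<in>?Q. pmf p x * pmf q y * (2 * \<tau> + 2 * ?e x + 2 * ?f y + ?e x * ?f y / \<tau> + ?f y * ln (1 / pmf p x)))"
    using \<tau> by (intro sum_mono mult_left_mono ln_guess_kernel_le(2)) auto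
  also have "\<dots> = (\<Sum>x\<in>?P. \<Sum>y\<in>?Q. (2 * \<tau>) * (pmf p x * pmf q y) + 2 * ((pmf p x * ?e x) * pmf q y) + 2 * (pmf p x * (pmf q y * ?f y))
      + (pmf p x * ?e x) * (pmf q y * ?f y) / \<tau> + (pmf p x * ln (1 / pmf p x)) * (pmf q y * ?f y))"
    by (simp add: algebra_simps)
  also have "\<dots> = 2 * \<tau> + 2 * \<alpha> + 2 * \<beta> + \<alpha> * \<beta> / \<tau> + shannon_entropy p * \<beta>"
    using fin
    by (simp only: sum.distrib sum_distrib_left[symmetric] sum_divide_distrib[symmetric] sum_product[symmetric]
        sum_pmf_neq sum_pmf_eq_1 order_refl \<alpha>_def \<beta>_def shannon_entropy_def[of p] mult_1_right mult_1_left
        sum_distrib_right[symmetric])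
  also have "\<alpha> * \<beta> / \<tau> \<le> \<tau>"
  proof -
    have "0 \<le> \<alpha>" "0 \<le> \<beta>" "\<tau> = \<alpha> + \<beta>" using \<tau>(3) by (auto simp: \<alpha>_def \<beta>_def pmf_le_1)
    then have "\<alpha> * \<beta> \<le> \<tau> * \<tau>" by (intro mult_mono) auto
    then show ?thesis using \<tau>(1) by (simp add: field_simps)
  qed
  finally show ?thesis
    using gibbs \<tau>(3) by (simp add: \<alpha>_def \<beta>_def mult.commute)
qed

text \<open>The exponent 40 makes the error small: 40\<tau> \<le> H(X) + H(Y), so 5\<tau> is at most
  an eighth of H(X) + H(Y), and so is the term with the factor 1 - q(y0). Hence H(X - Y) is at least
  3/4 of H(X) + H(Y), and the distance at least 1/4 of it.\<close>

lemma shannon_entropy_le_ent_dist_of_atoms: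
  fixes p q :: "'a::ab_group_add pmf"
  assumes fin: "finite (set_pmf p)" "finite (set_pmf q)"
    and atoms: "1 - exp (- 40) \<le> pmf p x0" "1 - exp (- 40) \<le> pmf q y0"
  shows "shannon_entropy p + shannon_entropy q \<le> 4 * ent_dist p q"
\<comment> \<open>Two point masses are treated apart, as the kernel needs \<tau> > 0.\<close>
proof (cases "pmf p x0 = 1 \<and> pmf q y0 = 1")
  case True
  then show ?thesis
    using ent_dist_nonneg[OF fin] by (simp add: shannon_entropy_eq_0[of p x0] shannon_entropy_eq_0[of q y0])
next
  case False
  define \<tau> where "\<tau> = (1 - pmf p x0) + (1 - pmf q y0)"
  have le1: "pmf p x0 \<le> 1" "pmf q y0 \<le> 1" by (simp_all add: pmf_le_1)
  have "41 \<le> exp (40 :: real)" using exp_ge_add_one_self[of "40 :: real"] by simp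
  then have e: "exp (- 40 :: real) \<le> 1 / 41" by (simp add: exp_minus field_simps)
  have \<tau>: "0 < \<tau>" "\<tau> \<le> 1 / 3" using False le1 atoms e by (auto simp: \<tau>_def)
  have "40 * \<tau> \<le> shannon_entropy p + shannon_entropy q"
    using shannon_entropy_ge_off_atom[OF fin(1) atoms(1)] shannon_entropy_ge_off_atom[OF fin(2) atoms(2)]
    by (simp add: \<tau>_def)
  moreover have "(1 - pmf q y0) * shannon_entropy p \<le> 1 / 8 * shannon_entropy p"
    using atoms e shannon_entropy_nonneg by (intro mult_right_mono) auto
  ultimately show ?thesis
    using shannon_entropy_add_le_pmf_diff[OF fin \<tau> \<tau>_def] shannon_entropy_nonneg[of q]
    by (simp add: ent_dist_alt)
qed

lemma ent_dist_dichotomy: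
  "\<exists>c>0. \<forall>p q :: int pmf. finite (set_pmf p) \<longrightarrow> finite (set_pmf q) \<longrightarrow>
     c \<le> ent_dist p q \<or> shannon_entropy p + shannon_entropy q \<le> 4 * ent_dist p q"
proof -
  define \<delta> :: real where "\<delta> = exp (- 40)"
  have \<delta>: "0 < \<delta>" by (simp add: \<delta>_def)
  \<comment> \<open>With these \<open>k\<close>, \<open>l\<close> and \<open>c\<close> the three
    terms of \<open>?\<theta>\<close> are at most \<delta>/4, \<delta>/8 and \<delta>/8, so
    2\<theta> \<le> \<delta>. The order matters: \<open>l\<close> depends on \<open>k\<close>, and
    \<open>c\<close> on both.\<close>
  obtain k :: nat where k: "4 / \<delta> < real k" using reals_Archimedean2 by blast
  have k0: "0 < real k" using k \<delta> by (meson divide_pos_pos less_trans zero_less_numeral)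
  define l where "l = \<delta> / (48 * real k)"
  have l: "0 < l" using \<delta> k0 by (simp add: l_def)
  define c where "c = \<delta> * l / (96 * real k)"
  have c: "0 < c" using \<delta> k0 l by (simp add: c_def)
  show ?thesis
  proof (intro exI[of _ c] conjI allI impI c)
    fix p q :: "int pmf"
    assume fin: "finite (set_pmf p)" "finite (set_pmf q)"
    show "c \<le> ent_dist p q \<or> shannon_entropy p + shannon_entropy q \<le> 4 * ent_dist p q"
    proof (cases "c \<le> ent_dist p q")
      case False
      let ?\<theta> = "1 / real k + 6 * real k * (l + 2 * ent_dist p q / l)"
      have "1 / real k \<le> \<delta> / 4" using k k0 \<delta> by (simp add: field_simps)
      moreover have "6 * real k * l = \<delta> / 8" using k0 by (simp add: l_def)
      moreover have "6 * real k * (2 * ent_dist p q / l) \<le> 6 * real k * (2 * c / l)"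
        using False k0 l by (intro mult_left_mono divide_right_mono) auto
      moreover have "6 * real k * (2 * c / l) = \<delta> / 8" using k0 l by (simp add: c_def)
      moreover have "?\<theta> = 1 / real k + (6 * real k * l + 6 * real k * (2 * ent_dist p q / l))"
        by (simp only: distrib_left)
      moreover have "2 * t \<le> \<delta>" if "a \<le> \<delta> / 4" "b = \<delta> / 8" "y \<le> z" "z = \<delta> / 8" "t = a + (b + y)" for t a b y z
        using that by linarith
      ultimately have "2 * ?\<theta> \<le> \<delta>" by blast
      moreover obtain x0 y0 where "1 - 2 * ?\<theta> \<le> pmf p x0" "1 - 2 * ?\<theta> \<le> pmf q y0"
        using atoms_of_small_ent_dist[OF fin _ l, of k] k0 by auto
      ultimately have "1 - \<delta> \<le> pmf p x0" "1 - \<delta> \<le> pmf q y0" by linarith+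
      then show ?thesis
        using shannon_entropy_le_ent_dist_of_atoms[OF fin] by (simp add: \<delta>_def)
    qed simp
  qed
qed

section \<open>Splitting sets along coordinates\<close>

lemma pmf_map_pmf_of_set:
  assumes "finite A" "A \<noteq> {}"
  shows "pmf (map_pmf f (pmf_of_set A)) v = card {x \<in> A. f x = v} / card A"
proof -
  have "A \<inter> f -` {v} = {x \<in> A. f x = v}" by auto
  then show ?thesis using assms by (simp add: pmf_map measure_pmf_of_set)
qed

lemma cond_pmf_of_set:
  assumes "finite A" "A \<inter> S \<noteq> {}"
  shows "cond_pmf (pmf_of_set A) S = pmf_of_set (A \<inter> S)"
proof (rule pmf_eqI)
  fix x
  have A: "A \<noteq> {}" using assms by auto
  then have ne: "set_pmf (pmf_of_set A) \<inter> S \<noteq> {}" using assms by simp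
  have "0 < card A" using A assms(1) by (simp add: card_gt_0_iff)
  then show "pmf (cond_pmf (pmf_of_set A) S) x = pmf (pmf_of_set (A \<inter> S)) x"
    using assms A by (simp add: pmf_cond[OF ne] measure_pmf_of_set pmf_of_set indicator_def)
qed

text \<open>A uniform law conditioned on a fibre is uniform on that fibre, so fibring keeps the
  fibre distances within the class of sets.\<close>

lemma ent_dist_set_fibring:
  fixes \<pi> :: "'a::ab_group_add \<Rightarrow> 'b::ab_group_add"
  assumes A: "finite A" "A \<noteq> {}" and B: "finite B" "B \<noteq> {}"
    and hom: "\<And>x y. \<pi> (x - y) = \<pi> x - \<pi> y"
  shows "ent_dist (map_pmf \<pi> (pmf_of_set A)) (map_pmf \<pi> (pmf_of_set B))
      + (\<Sum>a\<in>\<pi> ` A. \<Sum>b\<in>\<pi> ` B. pmf (map_pmf \<pi> (pmf_of_set A)) a * pmf (map_pmf \<pi> (pmf_of_set B)) b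
          * ent_dist_set {x \<in> A. \<pi> x = a} {y \<in> B. \<pi> y = b})
    \<le> ent_dist_set A B"
proof -
  have cond: "cond_pmf (pmf_of_set X) (\<pi> -` {v}) = pmf_of_set {x \<in> X. \<pi> x = v}"
    if "finite X" "X \<noteq> {}" "v \<in> \<pi> ` X" for X :: "'a set" and v
  proof -
    have "X \<inter> \<pi> -` {v} = {x \<in> X. \<pi> x = v}" by auto
    moreover have "X \<inter> \<pi> -` {v} \<noteq> {}" using that by auto
    ultimately show ?thesis using that by (simp add: cond_pmf_of_set)
  qed
  have "(\<Sum>a\<in>\<pi> ` A. \<Sum>b\<in>\<pi> ` B. pmf (map_pmf \<pi> (pmf_of_set A)) a * pmf (map_pmf \<pi> (pmf_of_set B)) b
          * ent_dist_set {x \<in> A. \<pi> x = a} {y \<in> B. \<pi> y = b})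
      = (\<Sum>a\<in>set_pmf (map_pmf \<pi> (pmf_of_set A)). \<Sum>b\<in>set_pmf (map_pmf \<pi> (pmf_of_set B)).
          pmf (map_pmf \<pi> (pmf_of_set A)) a * pmf (map_pmf \<pi> (pmf_of_set B)) b
            * ent_dist (cond_pmf (pmf_of_set A) (\<pi> -` {a})) (cond_pmf (pmf_of_set B) (\<pi> -` {b})))"
    using A B by (intro sum.cong) (auto simp: ent_dist_set_def cond)
  then show ?thesis
    using ent_dist_fibring[of "pmf_of_set A" "pmf_of_set B" \<pi>, OF _ _ hom] A B
    by (simp add: ent_dist_set_def)
qed

lemma ent_dist_set_nonneg:
  "finite A \<Longrightarrow> A \<noteq> {} \<Longrightarrow> finite B \<Longrightarrow> B \<noteq> {} \<Longrightarrow> 0 \<le> ent_dist_set A B"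
  unfolding ent_dist_set_def by (rule ent_dist_nonneg) auto

lemma ent_dist_set_singleton: "ent_dist_set {a} {b} = 0"
  by (simp add: ent_dist_set_def ent_dist_def pmf_of_set_singleton shannon_entropy_def)

section \<open>Induction on pairs of finite sets\<close>

lemma max_card_subset:
  assumes "finite X" "P {}"
  obtains F where "F \<subseteq> X" "P F" "\<And>F'. F' \<subseteq> X \<Longrightarrow> P F' \<Longrightarrow> card F' \<le> card F"
proof -
  have "finite (card ` {F. F \<subseteq> X \<and> P F})" using assms by simp
  moreover have "card ` {F. F \<subseteq> X \<and> P F} \<noteq> {}" using assms by auto
  ultimately have "Max (card ` {F. F \<subseteq> X \<and> P F}) \<in> card ` {F. F \<subseteq> X \<and> P F}" by (rule Max_in)
  then obtain F where "F \<subseteq> X" "P F" "card F = Max (card ` {F. F \<subseteq> X \<and> P F})" by auto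
  with \<open>finite (card ` {F. F \<subseteq> X \<and> P F})\<close> show ?thesis by (intro that[of F]) auto
qed

lemma skew_dim_le_empty: "skew_dim_le r I {}"
  by (rule skew_dim_le_mono[of 0]) auto

lemma exists_nonneg_of_weighted_sum_nonneg:
  fixes w f :: "'a \<Rightarrow> real"
  assumes "finite S" "S \<noteq> {}" "\<And>s. s \<in> S \<Longrightarrow> 0 < w s" "0 \<le> (\<Sum>s\<in>S. w s * f s)"
  shows "\<exists>s\<in>S. 0 \<le> f s"
proof (rule ccontr)
  assume "\<not> (\<exists>s\<in>S. 0 \<le> f s)"
  then have "(\<Sum>s\<in>S. w s * f s) < (\<Sum>s\<in>S. 0)"
    using assms by (intro sum_strict_mono) (auto intro!: mult_pos_neg simp: not_le)
  with assms(4) show False by simp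
qed

text \<open>The set \<open>I\<close> of free coordinates varies in the induction, since fibres lose
  a coordinate; constancy off \<open>I\<close> passes to fibres. One integer \<open>r\<close> serves
  both sets.\<close>

lemma exists_large_skew_subsets:
  fixes c C :: real
  assumes c: "0 < c" and gap: "\<And>p q :: int pmf. finite (set_pmf p) \<Longrightarrow> finite (set_pmf q) \<Longrightarrow>
     c \<le> ent_dist p q \<or> shannon_entropy p + shannon_entropy q \<le> 4 * ent_dist p q"
    and C: "4 \<le> C" "2 \<le> C * c"
    and A: "finite A" "A \<noteq> {}" and B: "finite B" "B \<noteq> {}"
    and const: "\<And>x y j. x \<in> A \<Longrightarrow> y \<in> A \<Longrightarrow> j \<notin> I \<Longrightarrow> x j = y j" "\<And>x y j. x \<in> B \<Longrightarrow> y \<in> B \<Longrightarrow> j \<notin> I \<Longrightarrow> x j = y j"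
  shows "\<exists>A' B' r. A' \<subseteq> A \<and> B' \<subseteq> B
    \<and> exp (- C * ent_dist_set A B) * (real (card A) * real (card B)) \<le> real (card A') * real (card B')
    \<and> real r \<le> C * ent_dist_set A B \<and> skew_dim_le r I A' \<and> skew_dim_le r I B'"
  using A B const
proof (induction "card A * card B" arbitrary: A B I rule: less_induct)
  case less
  note A = less.prems(1,2) and B = less.prems(3,4) and const = less.prems(5,6)
  show ?case
  proof (cases "\<exists>i\<in>I. (\<exists>x\<in>A. \<exists>y\<in>A. x i \<noteq> y i) \<or> (\<exists>x\<in>B. \<exists>y\<in>B. x i \<noteq> y i)")
    case False
    have "x = y" if "x \<in> A \<and> y \<in> A \<or> x \<in> B \<and> y \<in> B" for x y
    proof
      fix j show "x j = y j" using that False const[of x y j] by blast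
    qed
    then obtain a b where "A = {a}" "B = {b}" using A B by blast
    then show ?thesis
      by (intro exI[of _ A] exI[of _ B] exI[of _ 0]) (simp add: ent_dist_set_singleton)
  next
    case True
    then obtain i where i: "i \<in> I" and nc: "(\<exists>x\<in>A. \<exists>y\<in>A. x i \<noteq> y i) \<or> (\<exists>x\<in>B. \<exists>y\<in>B. x i \<noteq> y i)" by blast
    let ?\<pi> = "\<lambda>x :: nat \<Rightarrow> int. x i"
    define P where "P = map_pmf ?\<pi> (pmf_of_set A)"
    define Q where "Q = map_pmf ?\<pi> (pmf_of_set B)"
    define Af where "Af a = {x \<in> A. x i = a}" for a
    define Bf where "Bf b = {y \<in> B. y i = b}" for b
    define d where "d = ent_dist_set A B"
    define E where "E s = ent_dist_set (Af (fst s)) (Bf (snd s))" for s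
    define w where "w s = pmf P (fst s) * pmf Q (snd s)" for s
    let ?S = "?\<pi> ` A \<times> ?\<pi> ` B"
    have setP: "set_pmf P = ?\<pi> ` A" and setQ: "set_pmf Q = ?\<pi> ` B"
      using A B by (simp_all add: P_def Q_def)
    have finP: "finite (set_pmf P)" and finQ: "finite (set_pmf Q)" using A B by (simp_all add: setP setQ)
    have finS: "finite ?S" and neS: "?S \<noteq> {}" using A B by auto
    have cardA: "real (card (Af a)) = pmf P a * real (card A)" for a
      using A by (simp add: P_def Af_def pmf_map_pmf_of_set)
    have cardB: "real (card (Bf b)) = pmf Q b * real (card B)" for b
      using B by (simp add: Q_def Bf_def pmf_map_pmf_of_set)
    have wpos: "0 < w s" if "s \<in> ?S" for s
      using that by (auto simp: w_def setP[symmetric] setQ[symmetric] pmf_positive intro!: mult_pos_pos simp del: set_map_pmf)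
    have prodsum: "(\<Sum>s\<in>?S. f (fst s) * g (snd s)) = (\<Sum>a\<in>?\<pi> ` A. f a) * (\<Sum>b\<in>?\<pi> ` B. g b)" for f g :: "int \<Rightarrow> real"
      by (simp add: sum.cartesian_product' sum_product)
    have sumP: "sum (pmf P) (?\<pi> ` A) = 1" and sumQ: "sum (pmf Q) (?\<pi> ` B) = 1"
      using A B by (auto intro!: sum_pmf_eq_1 simp: setP setQ)
    have sumw: "sum w ?S = 1"
      unfolding w_def by (simp add: prodsum sumP sumQ)
    have fibring: "ent_dist P Q + (\<Sum>s\<in>?S. w s * E s) \<le> d"
      using ent_dist_set_fibring[OF A B, of ?\<pi>]
      by (simp add: P_def Q_def d_def E_def w_def Af_def Bf_def sum.cartesian_product')
    \<comment> \<open>\<open>J = I\<close> serves when a single pair of fibres replaces (A, B),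
      \<open>J = I - {i}\<close> when fibres are glued. The factor \<open>w s\<close> is the share
      of this pair of fibres in |A| |B|.\<close>
    have IH: "\<exists>A' B' r. A' \<subseteq> Af (fst s) \<and> B' \<subseteq> Bf (snd s)
        \<and> exp (- C * E s) * (w s * (real (card A) * real (card B))) \<le> real (card A') * real (card B')
        \<and> real r \<le> C * E s \<and> skew_dim_le r J A' \<and> skew_dim_le r J B'"
      if s: "s \<in> ?S" and J: "J = I \<or> J = I - {i}" for s J
    proof -
      have sub: "Af (fst s) \<subseteq> A" "Bf (snd s) \<subseteq> B" by (auto simp: Af_def Bf_def)
      have fin: "finite (Af (fst s))" "finite (Bf (snd s))" using sub A B finite_subset by blast+
      have ne: "Af (fst s) \<noteq> {}" "Bf (snd s) \<noteq> {}" using s by (auto simp: Af_def Bf_def)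
      have "Af (fst s) \<subset> A \<or> Bf (snd s) \<subset> B"
      proof (rule ccontr)
        assume "\<not> (Af (fst s) \<subset> A \<or> Bf (snd s) \<subset> B)"
        with sub have "Af (fst s) = A" "Bf (snd s) = B" by blast+
        then have "\<forall>x\<in>A. x i = fst s" "\<forall>x\<in>B. x i = snd s"
          unfolding Af_def Bf_def by blast+
        with nc show False by metis
      qed
      then have "card (Af (fst s)) * card (Bf (snd s)) < card A * card B"
      proof
        assume "Af (fst s) \<subset> A"
        then have "card (Af (fst s)) < card A" using A by (simp add: psubset_card_mono)
        moreover have "card (Bf (snd s)) \<le> card B" "0 < card B" using sub B by (auto simp: card_mono card_gt_0_iff)
        ultimately show ?thesis using ne fin
          by (meson card_gt_0_iff le_less_trans mult_le_mono2 mult_less_mono1)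
      next
        assume "Bf (snd s) \<subset> B"
        then have "card (Bf (snd s)) < card B" using B by (simp add: psubset_card_mono)
        moreover have "card (Af (fst s)) \<le> card A" "0 < card A" using sub A by (auto simp: card_mono card_gt_0_iff)
        ultimately show ?thesis using ne fin
          by (meson card_gt_0_iff le_less_trans mult_le_mono1 mult_less_mono2)
      qed
      moreover have "x j = y j" if "x \<in> Af (fst s)" "y \<in> Af (fst s)" "j \<notin> J" for x y j
        using that J const(1)[of x y j] by (cases "j = i") (auto simp: Af_def)
      moreover have "x j = y j" if "x \<in> Bf (snd s)" "y \<in> Bf (snd s)" "j \<notin> J" for x y j
        using that J const(2)[of x y j] by (cases "j = i") (auto simp: Bf_def)
      ultimately have "\<exists>A' B' r. A' \<subseteq> Af (fst s) \<and> B' \<subseteq> Bf (snd s)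
        \<and> exp (- C * E s) * (real (card (Af (fst s))) * real (card (Bf (snd s)))) \<le> real (card A') * real (card B')
        \<and> real r \<le> C * E s \<and> skew_dim_le r J A' \<and> skew_dim_le r J B'"
        unfolding E_def by (intro less.hyps fin ne)
      moreover have "real (card (Af (fst s))) * real (card (Bf (snd s))) = w s * (real (card A) * real (card B))"
        by (simp add: cardA cardB w_def)
      ultimately show ?thesis by simp
    qed
    have E0: "0 \<le> E s" if "s \<in> ?S" for s
      unfolding E_def using that A B by (intro ent_dist_set_nonneg) (auto simp: Af_def Bf_def)
    from gap[OF finP finQ] show ?thesis
    proof
      assume small: "shannon_entropy P + shannon_entropy Q \<le> 4 * ent_dist P Q"
      \<comment> \<open>\<open>?f s\<close> \<ge> 0 says that exp (-C E) times the share
        \<open>w s\<close> is at least exp (-C d): the drop in distance pays for the lost points.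
        The mean of ln w is minus the total entropy of the projections, hence C \<ge> 4.\<close>
      let ?f = "\<lambda>s. C * (d - E s) + ln (w s)"
      have "(\<Sum>s\<in>?S. w s * ln (w s)) = - (shannon_entropy P + shannon_entropy Q)"
      proof -
        have "w s * ln (w s) = - (pmf P (fst s) * ln (1 / pmf P (fst s)) * pmf Q (snd s)
            + pmf P (fst s) * (pmf Q (snd s) * ln (1 / pmf Q (snd s))))" if "s \<in> ?S" for s
        proof -
          have "0 < pmf P (fst s)" "0 < pmf Q (snd s)"
            using wpos[OF that] pmf_nonneg[of P "fst s"] pmf_nonneg[of Q "snd s"]
            by (auto simp: w_def zero_less_mult_iff)
          then show ?thesis by (simp add: w_def ln_mult ln_div algebra_simps)
        qed
        then have "(\<Sum>s\<in>?S. w s * ln (w s)) = - (\<Sum>s\<in>?S. pmf P (fst s) * ln (1 / pmf P (fst s)) * pmf Q (snd s)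
            + pmf P (fst s) * (pmf Q (snd s) * ln (1 / pmf Q (snd s))))"
          by (simp only: sum_negf[symmetric] cong: sum.cong)
        then show ?thesis
          by (simp only: sum.distrib prodsum[of "\<lambda>a. pmf P a * ln (1 / pmf P a)"]
              prodsum[of _ "\<lambda>b. pmf Q b * ln (1 / pmf Q b)"] sumP sumQ)
            (simp add: shannon_entropy_def setP setQ)
      qed
      moreover have "(\<Sum>s\<in>?S. w s * (C * (d - E s))) = C * (d - (\<Sum>s\<in>?S. w s * E s))"
      proof -
        have "(\<Sum>s\<in>?S. w s * (C * (d - E s))) = (\<Sum>s\<in>?S. C * d * w s - C * (w s * E s))"
          by (simp add: algebra_simps)
        then show ?thesis by (simp only: sum_subtractf sum_distrib_left[symmetric] sumw) (simp add: algebra_simps)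
      qed
      moreover have "C * ent_dist P Q \<le> C * (d - (\<Sum>s\<in>?S. w s * E s))"
        using fibring C by (intro mult_left_mono) auto
      moreover have "4 * ent_dist P Q \<le> C * ent_dist P Q"
        using C ent_dist_nonneg[OF finP finQ] by (intro mult_right_mono) auto
      ultimately have "0 \<le> (\<Sum>s\<in>?S. w s * ?f s)"
        using small by (simp only: distrib_left sum.distrib)
      then obtain s where s: "s \<in> ?S" "0 \<le> ?f s"
        using exists_nonneg_of_weighted_sum_nonneg[OF finS neS, of w ?f] wpos by auto
      obtain A' B' r where *: "A' \<subseteq> Af (fst s)" "B' \<subseteq> Bf (snd s)"
        "exp (- C * E s) * (w s * (real (card A) * real (card B))) \<le> real (card A') * real (card B')"
        "real r \<le> C * E s" "skew_dim_le r I A'" "skew_dim_le r I B'"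
        using IH[OF s(1), of I] by auto
      have "exp (- C * d) \<le> exp (- C * E s + ln (w s))"
        using s(2) by (simp add: algebra_simps)
      also have "\<dots> = exp (- C * E s) * w s"
        using wpos[OF s(1)] by (simp only: exp_add exp_ln)
      finally have "exp (- C * d) * (real (card A) * real (card B)) \<le> exp (- C * E s) * w s * (real (card A) * real (card B))"
        by (intro mult_right_mono) auto
      \<comment> \<open>A share is at most 1, so \<open>?f s\<close> \<ge> 0 also forces E \<le> d
        and the dimension bound carries over.\<close>
      moreover have "ln (w s) \<le> 0"
        using wpos[OF s(1)] by (simp add: w_def mult_le_one pmf_le_1)
      then have "C * E s \<le> C * d" using s(2) by (simp add: algebra_simps)
      ultimately show ?thesis
        using * by (intro exI[of _ A'] exI[of _ B'] exI[of _ r]) (auto simp: d_def[symmetric] Af_def Bf_def mult.assoc)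
    next
      assume large: "c \<le> ent_dist P Q"
      \<comment> \<open>On \<open>G\<close> the bound C E on the dimension has dropped by at least C
        c / 2 \<ge> 1, which leaves room for the coordinate \<open>i\<close>.\<close>
      define G where "G = {s \<in> ?S. E s \<le> d - c / 2}"
      have G: "G \<subseteq> ?S" "finite G" using finS by (auto simp: G_def)
      have gain: "c / 2 \<le> (\<Sum>s\<in>G. w s * (d - E s))"
      proof -
        have "c \<le> d - (\<Sum>s\<in>?S. w s * E s)" using fibring large by linarith
        also have "\<dots> = (\<Sum>s\<in>?S. w s * (d - E s))"
          by (simp add: right_diff_distrib sum_subtractf sum_distrib_right[symmetric] sumw)
        also have "\<dots> = (\<Sum>s\<in>?S - G. w s * (d - E s)) + (\<Sum>s\<in>G. w s * (d - E s))"
          by (rule sum.subset_diff[OF G(1) finS])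
        also have "(\<Sum>s\<in>?S - G. w s * (d - E s)) \<le> (\<Sum>s\<in>?S - G. w s * (c / 2))"
          using wpos by (intro sum_mono mult_left_mono) (auto simp: G_def less_imp_le)
        also have "\<dots> \<le> (\<Sum>s\<in>?S. w s * (c / 2))"
          using wpos c finS by (intro sum_mono2) (auto intro!: mult_nonneg_nonneg simp: less_imp_le)
        also have "\<dots> = c / 2" by (simp only: sum_distrib_right[symmetric] sumw)
        finally show ?thesis by simp
      qed
      then have "G \<noteq> {}" using c by auto
      then obtain s0 where "s0 \<in> ?S" "E s0 \<le> d - c / 2" by (auto simp: G_def)
      then have d0: "0 \<le> d - c / 2" using E0[of s0] by linarith
      \<comment> \<open>The common dimension budget of all pairs in \<open>G\<close>. By
        \<open>d0\<close> the floor is not cut off at 0, and R + 1 \<le> C d.\<close>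
      define R where "R = nat \<lfloor>C * (d - c / 2)\<rfloor>"
      have "0 \<le> C * (d - c / 2)" using C d0 by simp
      then have R: "real R \<le> C * (d - c / 2)" and R_ge: "\<And>r. real r \<le> C * (d - c / 2) \<Longrightarrow> r \<le> R"
        by (auto simp: R_def le_nat_floor)
      \<comment> \<open>The choice depends on the fibre alone, yet it is at least as large as the
        subset supplied by any pair in \<open>G\<close>.\<close>
      define F where "F X = (SOME F. F \<subseteq> X \<and> skew_dim_le R (I - {i}) F
          \<and> (\<forall>F'. F' \<subseteq> X \<longrightarrow> skew_dim_le R (I - {i}) F' \<longrightarrow> card F' \<le> card F))" for X
      have F: "F X \<subseteq> X \<and> skew_dim_le R (I - {i}) (F X)
          \<and> (\<forall>F'. F' \<subseteq> X \<longrightarrow> skew_dim_le R (I - {i}) F' \<longrightarrow> card F' \<le> card (F X))"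
        if "finite X" for X
      proof -
        have "\<exists>F. F \<subseteq> X \<and> skew_dim_le R (I - {i}) F
            \<and> (\<forall>F'. F' \<subseteq> X \<longrightarrow> skew_dim_le R (I - {i}) F' \<longrightarrow> card F' \<le> card F)"
          using max_card_subset[of X "skew_dim_le R (I - {i})"] that skew_dim_le_empty by metis
        then show ?thesis unfolding F_def by (rule someI_ex)
      qed
      have finAf: "finite (Af a)" and finBf: "finite (Bf a)" for a
        using A B by (simp_all add: Af_def Bf_def)
      define FA where "FA a = F (Af a)" for a
      define FB where "FB b = F (Bf b)" for b
      note FA = F[OF finAf, folded FA_def] and FB = F[OF finBf, folded FB_def]
      have union: "skew_dim_le (Suc R) I (\<Union>a\<in>?\<pi> ` X. F a)
          \<and> real (card (\<Union>a\<in>?\<pi> ` X. F a)) = (\<Sum>a\<in>?\<pi> ` X. real (card (F a)))"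
        if X: "finite X" and F: "\<And>a. F a \<subseteq> {x \<in> X. x i = a}" "\<And>a. skew_dim_le R (I - {i}) (F a)"
        for X and F :: "int \<Rightarrow> (nat \<Rightarrow> int) set"
      proof
        \<comment> \<open>Also valid for \<open>n\<close> outside the image of \<open>X\<close>,
          where both sides are empty.\<close>
        have "{x \<in> (\<Union>a\<in>?\<pi> ` X. F a). x i = n} = F n" for n
          using F(1) by fastforce
        then have "\<forall>n. skew_dim_le R (I - {i}) {x \<in> (\<Union>a\<in>?\<pi> ` X. F a). x i = n}"
          using F(2) by (simp only:) simp
        then show "skew_dim_le (Suc R) I (\<Union>a\<in>?\<pi> ` X. F a)"
          unfolding skew_dim_le.simps using i by blast
        have "card (\<Union>a\<in>?\<pi> ` X. F a) = (\<Sum>a\<in>?\<pi> ` X. card (F a))"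
          using X F(1) by (intro card_UN_disjoint) (auto intro: finite_subset[OF F(1)] dest!: subsetD[OF F(1)])
        then show "real (card (\<Union>a\<in>?\<pi> ` X. F a)) = (\<Sum>a\<in>?\<pi> ` X. real (card (F a)))" by simp
      qed
      let ?A' = "\<Union>a\<in>?\<pi> ` A. FA a" and ?B' = "\<Union>b\<in>?\<pi> ` B. FB b"
      have UA: "skew_dim_le (Suc R) I ?A' \<and> real (card ?A') = (\<Sum>a\<in>?\<pi> ` A. real (card (FA a)))"
        using FA by (intro union A) (simp_all add: Af_def)
      have UB: "skew_dim_le (Suc R) I ?B' \<and> real (card ?B') = (\<Sum>b\<in>?\<pi> ` B. real (card (FB b)))"
        using FB by (intro union B) (simp_all add: Bf_def)
      let ?N = "real (card A) * real (card B)"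
      have pair: "exp (- C * d) * C * ?N * (w s * (d - E s)) \<le> real (card (FA (fst s))) * real (card (FB (snd s)))"
        if s: "s \<in> G" for s
      proof -
        have s': "s \<in> ?S" and Es: "E s \<le> d - c / 2" using s by (auto simp: G_def)
        obtain A' B' r where *: "A' \<subseteq> Af (fst s)" "B' \<subseteq> Bf (snd s)"
          "exp (- C * E s) * (w s * ?N) \<le> real (card A') * real (card B')"
          "real r \<le> C * E s" "skew_dim_le r (I - {i}) A'" "skew_dim_le r (I - {i}) B'"
          using IH[OF s', of "I - {i}"] by auto
        have "C * E s \<le> C * (d - c / 2)" using Es C by (intro mult_left_mono) auto
        then have "r \<le> R" using *(4) by (intro R_ge) linarith
        then have "card A' \<le> card (FA (fst s))" "card B' \<le> card (FB (snd s))"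
          using * FA FB skew_dim_le_mono by metis+
        then have "real (card A') * real (card B') \<le> real (card (FA (fst s))) * real (card (FB (snd s)))"
          by (intro mult_mono) auto
        moreover have "exp (- C * d) * (C * (d - E s)) \<le> exp (- C * E s)"
        proof -
          \<comment> \<open>The linearisation t \<le> e^t gives a lower bound proportional to d - E,
            as it occurs in \<open>gain\<close>.\<close>
          have "C * (d - E s) \<le> exp (C * (d - E s))"
            using exp_ge_add_one_self[of "C * (d - E s)"] by linarith
          then have "exp (- C * d) * (C * (d - E s)) \<le> exp (- C * d) * exp (C * (d - E s))"
            by (intro mult_left_mono) auto
          also have "\<dots> = exp (- C * E s)" by (simp add: exp_add[symmetric] algebra_simps)
          finally show ?thesis .
        qed
        then have "exp (- C * d) * (C * (d - E s)) * (w s * ?N) \<le> exp (- C * E s) * (w s * ?N)"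
          using wpos[OF s'] by (intro mult_right_mono) auto
        ultimately show ?thesis using *(3) by (simp add: mult_ac)
      qed
      \<comment> \<open>The second use of C c \<ge> 2: the factor C from the linearisation
        compensates the gain c/2.\<close>
      have "exp (- C * d) * ?N * 1 \<le> exp (- C * d) * ?N * (C * (c / 2))"
        using C by (intro mult_left_mono) auto
      also have "\<dots> = exp (- C * d) * C * ?N * (c / 2)" by simp
      also have "\<dots> \<le> exp (- C * d) * C * ?N * (\<Sum>s\<in>G. w s * (d - E s))"
        using gain C by (intro mult_left_mono) auto
      also have "\<dots> \<le> (\<Sum>s\<in>G. real (card (FA (fst s))) * real (card (FB (snd s))))"
        unfolding sum_distrib_left by (intro sum_mono pair)
      also have "\<dots> \<le> (\<Sum>s\<in>?S. real (card (FA (fst s))) * real (card (FB (snd s))))"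
        using finS G by (intro sum_mono2) auto
      also have "\<dots> = real (card ?A') * real (card ?B')"
        unfolding UA[THEN conjunct2] UB[THEN conjunct2] by (rule prodsum)
      finally have "exp (- C * d) * ?N \<le> real (card ?A') * real (card ?B')" by simp
      moreover have "real (Suc R) \<le> C * d"
        using R C by (simp add: right_diff_distrib)
      moreover have "?A' \<subseteq> A" "?B' \<subseteq> B" using FA FB by (fastforce simp: Af_def Bf_def)+
      ultimately show ?thesis
        using UA UB unfolding d_def by blast
    qed
  qed
qed

theorem theorem1p6:
  "\<exists>C::real. \<forall>(D::nat) (A::(nat \<Rightarrow> int) set) (B::(nat \<Rightarrow> int) set).
     A \<subseteq> int_vecs D \<longrightarrow> finite A \<longrightarrow> A \<noteq> {} \<longrightarrow>
     B \<subseteq> int_vecs D \<longrightarrow> finite B \<longrightarrow> B \<noteq> {} \<longrightarrow>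
     (\<exists>A' B'. A' \<subseteq> A \<and> B' \<subseteq> B \<and>
        real (card A') * real (card B')
          \<ge> exp (- C * ent_dist_set A B) * real (card A) * real (card B) \<and>
        real (skew_dim {..<D} A') \<le> C * ent_dist_set A B \<and>
        real (skew_dim {..<D} B') \<le> C * ent_dist_set A B)"
proof -
  obtain c where c: "0 < c" and gap: "\<And>p q :: int pmf. finite (set_pmf p) \<Longrightarrow> finite (set_pmf q) \<Longrightarrow>
     c \<le> ent_dist p q \<or> shannon_entropy p + shannon_entropy q \<le> 4 * ent_dist p q"
    using ent_dist_dichotomy by blast
  \<comment> \<open>The 4 comes from the entropy comparison; 2 / c makes a drop of c/2 worth one
    dimension.\<close>
  define C where "C = max 4 (2 / c)"
  have C: "4 \<le> C" "2 \<le> C * c"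
    using c by (auto simp: C_def max_def field_simps)
  show ?thesis
  proof (intro exI[of _ C] allI impI)
    fix D and A B :: "(nat \<Rightarrow> int) set"
    assume *: "A \<subseteq> int_vecs D" "finite A" "A \<noteq> {}" "B \<subseteq> int_vecs D" "finite B" "B \<noteq> {}"
    have const: "x j = y j" if "X \<subseteq> int_vecs D" "x \<in> X" "y \<in> X" "j \<notin> {..<D}" for X x y j
    proof -
      have "x \<in> int_vecs D" "y \<in> int_vecs D" using that by auto
      then show ?thesis using that(4) by (simp add: int_vecs_def)
    qed
    have "\<exists>A' B' r. A' \<subseteq> A \<and> B' \<subseteq> B
      \<and> exp (- C * ent_dist_set A B) * (real (card A) * real (card B)) \<le> real (card A') * real (card B')
      \<and> real r \<le> C * ent_dist_set A B \<and> skew_dim_le r {..<D} A' \<and> skew_dim_le r {..<D} B'"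
      by (rule exists_large_skew_subsets[OF c gap C *(2,3,5,6)])
        (use const[OF *(1)] const[OF *(4)] in blast)+
    then obtain A' B' r where "A' \<subseteq> A" "B' \<subseteq> B"
      "exp (- C * ent_dist_set A B) * (real (card A) * real (card B)) \<le> real (card A') * real (card B')"
      "real r \<le> C * ent_dist_set A B" "skew_dim_le r {..<D} A'" "skew_dim_le r {..<D} B'"
      by blast
    moreover from this * have "skew_dim {..<D} A' \<le> r" "skew_dim {..<D} B' \<le> r"
      by (subst skew_dim_le_iff; auto)+
    ultimately show "\<exists>A' B'. A' \<subseteq> A \<and> B' \<subseteq> B \<and>
        real (card A') * real (card B') \<ge> exp (- C * ent_dist_set A B) * real (card A) * real (card B) \<and>
        real (skew_dim {..<D} A') \<le> C * ent_dist_set A B \<and>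
        real (skew_dim {..<D} B') \<le> C * ent_dist_set A B"
      by (intro exI[of _ A'] exI[of _ B']) (auto simp: mult.assoc)
  qed
qed

end
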